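(* Let $\rho_0\in\mathcal{P}_2(\mathbb{R}^d)$ have a nonsingular second moment matrix and satisfy $\mathsf{H}(\rho_0\|\gamma)<\infty$. The IGW gradient flow $(\rho_t)_{t\in[0,\infty)}$ of $\mathsf{H}(\cdot\|\gamma)$ started at $\rho_0$ solves the nonlinear Fokker--Planck equation $$\partial_t\mu_t(x)-\nabla\cdot\Big(\tfrac12\Sigma_{\mu_t}^{-1}\nabla\mu_t(x)+\tfrac14\big(\Sigma_{\mu_t}^{-1}+\Sigma_{\mu_t}^{-2}\big)x\,\mu_t(x)\Big)=0$$ in the distributional sense on $\mathbb{R}^d\times(0,\infty)$.
   Context: Notation. $\mathcal{P}_2(\mathbb{R}^d)$: Borel probability measures on $\mathbb{R}^d$ with finite second moment; $\Sigma_\mu=\int xx^\intercal d\mu(x)$ (uncentered second moment matrix); $\lambda_{\min}$: smallest eigenvalue; $\gamma=\mathcal{N}(0,I)$; $\mathsf{H}(\mu\|\gamma)=\int\log\frac{d\mu}{d\gamma}d\mu$ if $\mu\ll\gamma$ and $+\infty$ otherwise; $\mathsf{W}_2$: 2-Wasserstein distance; absolutely continuous measures are identified with their Lebesgue densities. A curve $(\mu_t)$ solves the Fokker--Planck equation in the distributional sense if $\int_0^\infty\int\big[\partial_t\varphi+\frac12\mathrm{tr}(\Sigma_{\mu_t}^{-1}\nabla_x^2\varphi)-\frac14\langle(\Sigma_{\mu_t}^{-1}+\Sigma_{\mu_t}^{-2})x,\nabla_x\varphi\rangle\big]d\mu_t\,dt=0$ for all $\varphi\in C_c^\infty((0,\infty)\times\mathbb{R}^d)$.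 IGW distance: $\mathsf{IGW}(\mu,\nu)=\big(\inf_{\pi\in\Pi(\mu,\nu)}\int|\langle x,x'\rangle-\langle y,y'\rangle|^2d\pi\otimes\pi(x,y,x',y')\big)^{1/2}$ over couplings; minimizers are optimal IGW couplings. $\mathcal{O}_{\mu,\nu}$ is the set of orthogonal matrices $PQ^\intercal$, where $P\Lambda Q^\intercal$ is a singular value decomposition of $\int xy^\intercal d\pi^\star(x,y)$ for some optimal IGW coupling $\pi^\star$. IGW--JKO scheme on $[0,\delta]$ for $\mathsf{F}=\mathsf{H}(\cdot\|\gamma)$ started at $\rho_0$: with $\tau=\delta/n$, $\rho_0^\tau=\rho_0$, for $i=0,\dots,n-1$ choose $\tilde\rho_{i+1}^\tau\in\operatorname{argmin}_{\rho\in\mathcal{P}_2(\mathbb{R}^d)}\mathsf{F}(\rho)+\frac1{2\tau}\mathsf{IGW}^2(\rho,\rho_i^\tau)$ and $\rho_{i+1}^\tau=O_\#\tilde\rho_{i+1}^\tau$ with $O\in\mathcal{O}_{\rho_i^\tau,\tilde\rho_{i+1}^\tau}$; set $\bar\rho^n_0=\rho_0$, $\bar\rho^n_t=\rho_i^\tau$ for $t\in((i-1)\tau,i\tau]$. Mobility operator: $\mathcal{L}_\mu[v](x)=2\Sigma_\mu v(x)+2\big(\int y\,v(y)^\intercal d\mu(y)\big)x$ on $L^2(\mu;\mathbb{R}^d)$; $\mathcal{I}_\mu=\{v\in L^2(\mu;\mathbb{R}^d):\int xv(x)^\intercal d\mu(x)\text{ symmetric}\}$; for $\Sigma_\mu$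 nonsingular, $\mathcal{L}_\mu|_{\mathcal{I}_\mu}$ is a bijection of $\mathcal{I}_\mu$ with bounded inverse. Subdifferentials of $\mathsf{F}=\mathsf{H}(\cdot\|\gamma)$: $\partial\mathsf{F}(\mu)$ is the set of $\xi\in L^2(\mu;\mathbb{R}^d)$ with $\mathsf{F}(T_\#\mu)-\mathsf{F}(\mu)\ge\int\langle\xi,T-\mathrm{id}\rangle d\mu+o(\|T-\mathrm{id}\|_{L^2(\mu)})$ for all $T\in L^2(\mu;\mathbb{R}^d)$; $\partial_\ell\mathsf{F}(\mu)$ is the set of $\xi\in L^2(\mu;\mathbb{R}^d)$ for which there are $\mu_k\to\mu$ weakly and $\xi_k\in\partial\mathsf{F}(\mu_k)$ with $\int\langle g,\xi_k\rangle d\mu_k\to\int\langle g,\xi\rangle d\mu$ for all $g\in C_c^\infty(\mathbb{R}^d;\mathbb{R}^d)$ and $\sup_k(\mathsf{F}(\mu_k)+\int(\|x\|^2+\|\xi_k\|^2)d\mu_k)<\infty$. IGW gradient flow. For $\rho_0$ as in the claim and $0<\delta<\delta_{\rho_0}=\frac{(1-1/\sqrt2)\lambda_{\min}(\Sigma_{\rho_0})}{2^{5/4}\mathsf{H}(\rho_0\|\gamma)}$, the interpolants $\bar\rho^n$ converge (along a subsequence, uniformly in $\mathsf{W}_2$) to a $\mathsf{W}_2$-continuous curve on $[0,\delta]$. The IGW gradient flow $(\rho_t)_{t\in[0,\infty)}$ is the curve obtained by concatenating such limits: the scheme is restarted at the endpoint of the previous time interval (with admissible interval lengths) so that the intervals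 cover $[0,\infty)$. It is $\mathsf{W}_2$-continuous, and with its velocity field $(v_t)$ it satisfies $\partial_t\rho_t+\nabla\cdot(\rho_tv_t)=0$ in the distributional sense on $\mathbb{R}^d\times(0,\infty)$ and $v_t\in-(\mathcal{L}_{\rho_t}|_{\mathcal{I}_{\rho_t}})^{-1}[\partial_\ell\mathsf{H}(\rho_t\|\gamma)]$ for a.e. $t$ (i.e. $v_t\in\mathcal{I}_{\rho_t}$, $-\mathcal{L}_{\rho_t}[v_t]\in\partial_\ell\mathsf{H}(\rho_t\|\gamma)$). *)

theory Defs
  imports "HOL-Probability.Probability"
begin

section \<open>Measures, moments, entropy\<close>

definition P2 :: "(real^'n) measure set" where
  "P2 = {\<mu>. prob_space \<mu> \<and> sets \<mu> = sets borel \<and> integrable \<mu> (\<lambda>x. (norm x)\<^sup>2)}"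

definition outer :: "real^'n \<Rightarrow> real^'n \<Rightarrow> real^'n^'n" where
  "outer x y = (\<chi> i j. x $ i * y $ j)"

definition second_moment :: "(real^'n) measure \<Rightarrow> real^'n^'n" where
  "second_moment \<mu> = (\<integral>x. outer x x \<partial>\<mu>)"

definition lambda_min :: "real^'n^'n \<Rightarrow> real" where
  "lambda_min A = Min {l. \<exists>x. x \<noteq> 0 \<and> A *v x = l *\<^sub>R x}"

definition std_gaussian :: "(real^'n) measure" where
  "std_gaussian = density lborel (\<lambda>x. ennreal (\<Prod>i\<in>UNIV. std_normal_density (x $ i)))"

text \<open>The library's \<^const>\<open>KL_divergence\<close> is a Bochner integral, hence \<open>0\<close> when the
  log-density is not integrable. The negative part of the log-density is always integrable for
  probability measures, so in that case the true value is \<open>\<infinity>\<close>. The library's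
  \<^term>\<open>absolutely_continuous \<nu> \<mu>\<close> means \<open>\<mu> \<lless> \<nu>\<close>.\<close>

definition relative_entropy :: "(real^'n) measure \<Rightarrow> (real^'n) measure \<Rightarrow> ereal" where
  "relative_entropy \<mu> \<nu> =
     (if absolutely_continuous \<nu> \<mu> \<and> integrable \<mu> (entropy_density (exp 1) \<nu> \<mu>)
      then ereal (KL_divergence (exp 1) \<nu> \<mu>) else \<infinity>)"

definition gaussian_entropy :: "(real^'n) measure \<Rightarrow> ereal" where
  "gaussian_entropy \<mu> = relative_entropy \<mu> std_gaussian"


section \<open>Couplings, Wasserstein and inner product Gromov--Wasserstein distances\<close>

text \<open>Both distances are only used on \<^const>\<open>P2\<close>, where all the integrands below are integrable
  for every coupling.\<close>

definition couplings ::
  "(real^'n) measure \<Rightarrow> (real^'n) measure \<Rightarrow> ((real^'n) \<times> (real^'n)) measure set" where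
  "couplings \<mu> \<nu> = {\<pi>. sets \<pi> = sets borel \<and> distr \<pi> borel fst = \<mu> \<and> distr \<pi> borel snd = \<nu>}"

definition W2 :: "(real^'n) measure \<Rightarrow> (real^'n) measure \<Rightarrow> real" where
  "W2 \<mu> \<nu> = sqrt (INF \<pi>\<in>couplings \<mu> \<nu>. \<integral>z. (norm (fst z - snd z))\<^sup>2 \<partial>\<pi>)"

definition IGW_cost :: "((real^'n) \<times> (real^'n)) measure \<Rightarrow> real" where
  "IGW_cost \<pi> = (\<integral>(z, z'). \<bar>fst z \<bullet> fst z' - snd z \<bullet> snd z'\<bar>\<^sup>2 \<partial>(\<pi> \<Otimes>\<^sub>M \<pi>))"

definition IGW :: "(real^'n) measure \<Rightarrow> (real^'n) measure \<Rightarrow> real" where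
  "IGW \<mu> \<nu> = sqrt (INF \<pi>\<in>couplings \<mu> \<nu>. IGW_cost \<pi>)"

definition optimal_IGW_coupling ::
  "(real^'n) measure \<Rightarrow> (real^'n) measure \<Rightarrow> ((real^'n) \<times> (real^'n)) measure \<Rightarrow> bool" where
  "optimal_IGW_coupling \<mu> \<nu> \<pi> \<longleftrightarrow> is_arg_min IGW_cost (\<lambda>\<pi>. \<pi> \<in> couplings \<mu> \<nu>) \<pi>"

definition singular_value_decomposition ::
  "real^'n^'n \<Rightarrow> real^'n^'n \<Rightarrow> real^'n^'n \<Rightarrow> real^'n^'n \<Rightarrow> bool" where
  "singular_value_decomposition A P L Q \<longleftrightarrow>
     orthogonal_matrix P \<and> orthogonal_matrix Q \<and>
     (\<forall>i j. i \<noteq> j \<longrightarrow> L $ i $ j = 0) \<and> (\<forall>i. 0 \<le> L $ i $ i) \<and>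
     A = P ** L ** transpose Q"

definition IGW_rotations :: "(real^'n) measure \<Rightarrow> (real^'n) measure \<Rightarrow> (real^'n^'n) set" where
  "IGW_rotations \<mu> \<nu> = {P ** transpose Q | P Q. \<exists>\<pi> L. optimal_IGW_coupling \<mu> \<nu> \<pi> \<and>
     singular_value_decomposition (\<integral>z. outer (fst z) (snd z) \<partial>\<pi>) P L Q}"

definition W2_continuous_on :: "real set \<Rightarrow> (real \<Rightarrow> (real^'n) measure) \<Rightarrow> bool" where
  "W2_continuous_on I \<rho> \<longleftrightarrow>
     (\<forall>t\<in>I. \<rho> t \<in> P2) \<and> (\<forall>t\<in>I. ((\<lambda>s. W2 (\<rho> s) (\<rho> t)) \<longlongrightarrow> 0) (at t within I))"


section \<open>The IGW--JKO scheme\<close>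

definition IGW_JKO_step ::
  "((real^'n) measure \<Rightarrow> ereal) \<Rightarrow> real \<Rightarrow> (real^'n) measure \<Rightarrow> (real^'n) measure \<Rightarrow> bool" where
  "IGW_JKO_step F \<tau> \<mu> \<mu>' \<longleftrightarrow>
     (\<exists>\<nu> U. is_arg_min (\<lambda>\<rho>. F \<rho> + ereal (1 / (2 * \<tau>) * (IGW \<rho> \<mu>)\<^sup>2)) (\<lambda>\<rho>. \<rho> \<in> P2) \<nu> \<and>
            U \<in> IGW_rotations \<mu> \<nu> \<and> \<mu>' = distr \<nu> borel (\<lambda>x. U *v x))"

definition IGW_JKO_scheme ::
  "((real^'n) measure \<Rightarrow> ereal) \<Rightarrow> (real^'n) measure \<Rightarrow> real \<Rightarrow> nat \<Rightarrow> (nat \<Rightarrow> (real^'n) measure) \<Rightarrow> bool"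
where
  "IGW_JKO_scheme F \<rho>0 \<delta> n S \<longleftrightarrow>
     S 0 = \<rho>0 \<and> (\<forall>i<n. IGW_JKO_step F (\<delta> / real n) (S i) (S (Suc i)))"

text \<open>For \<open>t > 0\<close>, the index \<open>i\<close> with \<open>t \<in> ((i - 1)\<tau>, i\<tau>]\<close> is \<open>\<lceil>t / \<tau>\<rceil>\<close>;
  \<open>t = 0\<close> gives \<open>S 0\<close>.\<close>

definition interpolant :: "real \<Rightarrow> nat \<Rightarrow> (nat \<Rightarrow> (real^'n) measure) \<Rightarrow> real \<Rightarrow> (real^'n) measure" where
  "interpolant \<delta> n S t = S (nat \<lceil>t / (\<delta> / real n)\<rceil>)"

definition IGW_JKO_limit ::
  "((real^'n) measure \<Rightarrow> ereal) \<Rightarrow> (real^'n) measure \<Rightarrow> real \<Rightarrow> (real \<Rightarrow> (real^'n) measure) \<Rightarrow> bool" where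
  "IGW_JKO_limit F \<rho>0 \<delta> \<sigma> \<longleftrightarrow>
     W2_continuous_on {0..\<delta>} \<sigma> \<and>
     (\<exists>S r. (\<forall>n\<ge>1. IGW_JKO_scheme F \<rho>0 \<delta> n (S n)) \<and> strict_mono (r :: nat \<Rightarrow> nat) \<and>
        (\<forall>e>0. \<forall>\<^sub>F k in sequentially. \<forall>t\<in>{0..\<delta>}.
           W2 (interpolant \<delta> (r k) (S (r k)) t) (\<sigma> t) < e))"


section \<open>Mobility operator and subdifferentials\<close>

definition L2 :: "(real^'n) measure \<Rightarrow> (real^'n \<Rightarrow> real^'n) set" where
  "L2 \<mu> = {v. v \<in> borel_measurable borel \<and> integrable \<mu> (\<lambda>x. (norm (v x))\<^sup>2)}"

definition L2_norm :: "(real^'n) measure \<Rightarrow> (real^'n \<Rightarrow> real^'n) \<Rightarrow> real" where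
  "L2_norm \<mu> v = sqrt (\<integral>x. (norm (v x))\<^sup>2 \<partial>\<mu>)"

definition mobility :: "(real^'n) measure \<Rightarrow> (real^'n \<Rightarrow> real^'n) \<Rightarrow> real^'n \<Rightarrow> real^'n" where
  "mobility \<mu> v x = 2 *\<^sub>R (second_moment \<mu> *v v x) + 2 *\<^sub>R ((\<integral>y. outer y (v y) \<partial>\<mu>) *v x)"

definition symmetric_fields :: "(real^'n) measure \<Rightarrow> (real^'n \<Rightarrow> real^'n) set" where
  "symmetric_fields \<mu> =
     {v \<in> L2 \<mu>. transpose (\<integral>x. outer x (v x) \<partial>\<mu>) = (\<integral>x. outer x (v x) \<partial>\<mu>)}"

definition subdifferential ::
  "((real^'n) measure \<Rightarrow> ereal) \<Rightarrow> (real^'n) measure \<Rightarrow> (real^'n \<Rightarrow> real^'n) set" where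
  "subdifferential F \<mu> = {\<xi> \<in> L2 \<mu>. \<mu> \<in> P2 \<and> F \<mu> < \<infinity> \<and>
     (\<forall>e>0. \<exists>d>0. \<forall>T\<in>L2 \<mu>. L2_norm \<mu> (\<lambda>x. T x - x) < d \<longrightarrow>
        F \<mu> + ereal ((\<integral>x. \<xi> x \<bullet> (T x - x) \<partial>\<mu>) - e * L2_norm \<mu> (\<lambda>x. T x - x))
          \<le> F (distr \<mu> borel T))}"

primrec C_k :: "nat \<Rightarrow> ('a::euclidean_space \<Rightarrow> 'b::real_normed_vector) \<Rightarrow> bool" where
  "C_k 0 f \<longleftrightarrow> continuous_on UNIV f"
| "C_k (Suc k) f \<longleftrightarrow>
     (\<forall>x. f differentiable (at x)) \<and> (\<forall>h. C_k k (\<lambda>x. frechet_derivative f (at x) h))"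

text \<open>Test functions on an open set \<open>U\<close>, extended by zero to the whole space.\<close>

definition test_functions ::
  "'a::euclidean_space set \<Rightarrow> ('a \<Rightarrow> 'b::real_normed_vector) set" where
  "test_functions U = {\<phi>. (\<forall>k. C_k k \<phi>) \<and>
     compact (closure {z. \<phi> z \<noteq> 0}) \<and> closure {z. \<phi> z \<noteq> 0} \<subseteq> U}"

definition weakly_converges :: "(nat \<Rightarrow> (real^'n) measure) \<Rightarrow> (real^'n) measure \<Rightarrow> bool" where
  "weakly_converges M \<mu> \<longleftrightarrow>
     (\<forall>f :: real^'n \<Rightarrow> real. continuous_on UNIV f \<and> bounded (range f) \<longrightarrow>
        (\<lambda>k. \<integral>x. f x \<partial>M k) \<longlonglongrightarrow> (\<integral>x. f x \<partial>\<mu>))"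

definition limiting_subdifferential ::
  "((real^'n) measure \<Rightarrow> ereal) \<Rightarrow> (real^'n) measure \<Rightarrow> (real^'n \<Rightarrow> real^'n) set" where
  "limiting_subdifferential F \<mu> = {\<xi> \<in> L2 \<mu>. \<exists>M \<Xi>.
     weakly_converges M \<mu> \<and> (\<forall>k. \<Xi> k \<in> subdifferential F (M k)) \<and>
     (\<forall>g \<in> test_functions UNIV. (\<lambda>k. \<integral>x. g x \<bullet> \<Xi> k x \<partial>M k) \<longlonglongrightarrow> (\<integral>x. g x \<bullet> \<xi> x \<partial>\<mu>)) \<and>
     (SUP k. F (M k) + ereal (\<integral>x. (norm x)\<^sup>2 + (norm (\<Xi> k x))\<^sup>2 \<partial>M k)) < \<infinity>}"


section \<open>Distributional equations on space-time\<close>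

definition gradient :: "(real^'n \<Rightarrow> real) \<Rightarrow> real^'n \<Rightarrow> real^'n" where
  "gradient f x = (\<chi> i. frechet_derivative f (at x) (axis i 1))"

definition hessian :: "(real^'n \<Rightarrow> real) \<Rightarrow> real^'n \<Rightarrow> real^'n^'n" where
  "hessian f x = (\<chi> i j. frechet_derivative (\<lambda>y. gradient f y $ i) (at x) (axis j 1))"

text \<open>\<^term>\<open>has_bochner_integral\<close> with value \<open>0\<close> also asserts that the outer integral exists.\<close>

definition continuity_equation ::
  "(real \<Rightarrow> (real^'n) measure) \<Rightarrow> (real \<Rightarrow> real^'n \<Rightarrow> real^'n) \<Rightarrow> bool" where
  "continuity_equation \<rho> v \<longleftrightarrow>
     (\<lambda>z. v (fst z) (snd z)) \<in> borel_measurable borel \<and>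
     (\<forall>a b. 0 < a \<longrightarrow> (\<integral>\<^sup>+t\<in>{a..b}. (\<integral>\<^sup>+x. ennreal (norm (v t x)) \<partial>\<rho> t) \<partial>lborel) < \<infinity>) \<and>
     (\<forall>\<phi> \<in> test_functions ({0<..} \<times> UNIV).
        has_bochner_integral lebesgue
          (\<lambda>t. indicator {0<..} t *\<^sub>R
             (\<integral>x. deriv (\<lambda>s. \<phi> (s, x)) t + v t x \<bullet> gradient (\<lambda>y. \<phi> (t, y)) x \<partial>\<rho> t))
          (0::real))"

text \<open>The equation involves the inverse of the second moment matrix, whose existence is made
  explicit since \<^const>\<open>matrix_inv\<close> is unspecified on singular matrices.\<close>

definition solves_IGW_Fokker_Planck :: "(real \<Rightarrow> (real^'n) measure) \<Rightarrow> bool" where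
  "solves_IGW_Fokker_Planck \<mu> \<longleftrightarrow>
     (AE t in lebesgue. 0 < t \<longrightarrow> invertible (second_moment (\<mu> t))) \<and>
     (\<forall>\<phi> \<in> test_functions ({0<..} \<times> UNIV).
        has_bochner_integral lebesgue
          (\<lambda>t. indicator {0<..} t *\<^sub>R
             (let R = matrix_inv (second_moment (\<mu> t)) in
              \<integral>x. deriv (\<lambda>s. \<phi> (s, x)) t
                + 1/2 * trace (R ** hessian (\<lambda>y. \<phi> (t, y)) x)
                - 1/4 * (((R + R ** R) *v x) \<bullet> gradient (\<lambda>y. \<phi> (t, y)) x) \<partial>\<mu> t))
          (0::real))"


section \<open>The IGW gradient flow of the Gaussian relative entropy\<close>

text \<open>The threshold is \<open>\<infinity>\<close> when the entropy vanishes and \<open>\<lambda>\<^sub>m\<^sub>i\<^sub>n\<close> is positive.\<close>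

definition max_step :: "(real^'n) measure \<Rightarrow> ereal" where
  "max_step \<rho> = ereal ((1 - 1 / sqrt 2) * lambda_min (second_moment \<rho>))
                / (ereal (2 powr (5/4)) * gaussian_entropy \<rho>)"

definition concatenated_IGW_JKO_limits ::
  "(real^'n) measure \<Rightarrow> (real \<Rightarrow> (real^'n) measure) \<Rightarrow> bool" where
  "concatenated_IGW_JKO_limits \<rho>0 \<rho> \<longleftrightarrow>
     \<rho> 0 = \<rho>0 \<and>
     (\<exists>T :: nat \<Rightarrow> real. T 0 = 0 \<and> filterlim T at_top sequentially \<and>
        (\<forall>k. T k < T (Suc k) \<and> ereal (T (Suc k) - T k) < max_step (\<rho> (T k)) \<and>
             IGW_JKO_limit gaussian_entropy (\<rho> (T k)) (T (Suc k) - T k) (\<lambda>s. \<rho> (T k + s))))"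

definition IGW_velocity_field ::
  "(real \<Rightarrow> (real^'n) measure) \<Rightarrow> (real \<Rightarrow> real^'n \<Rightarrow> real^'n) \<Rightarrow> bool" where
  "IGW_velocity_field \<rho> v \<longleftrightarrow>
     continuity_equation \<rho> v \<and>
     (AE t in lebesgue. 0 < t \<longrightarrow> v t \<in> symmetric_fields (\<rho> t) \<and>
        (\<lambda>x. - mobility (\<rho> t) (v t) x) \<in> limiting_subdifferential gaussian_entropy (\<rho> t))"

definition IGW_gradient_flow :: "(real^'n) measure \<Rightarrow> (real \<Rightarrow> (real^'n) measure) \<Rightarrow> bool" where
  "IGW_gradient_flow \<rho>0 \<rho> \<longleftrightarrow>
     concatenated_IGW_JKO_limits \<rho>0 \<rho> \<and> W2_continuous_on {0..} \<rho> \<and> (\<exists>v. IGW_velocity_field \<rho> v)"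

end

theory Submission
  imports Defs
begin

text \<open>Perturbing \<open>\<mu>\<close> by the shears \<open>x \<mapsto> x + s \<phi>(x) e\<close>, for which the entropy changes by an explicit
  amount, shows that every \<open>\<xi> \<in> \<partial>H(\<mu>|\<gamma>)\<close> satisfies \<open>\<integral>\<phi> (e \<bullet> \<xi>) d\<mu> = \<integral>((x \<bullet> e) \<phi> - \<partial>\<^sub>e \<phi>) d\<mu>\<close> for
  test functions \<open>\<phi>\<close>; this identity passes to the limiting subdifferential. Cutting off linear
  functions gives \<open>\<integral>\<xi> x\<^sup>T d\<mu> = \<Sigma> - I\<close>, which forces \<open>\<Sigma>\<close> to be positive definite. For
  \<open>\<xi> = -(2 \<Sigma> v + 2 B x)\<close> with \<open>B = \<integral>x v\<^sup>T d\<mu>\<close> symmetric it becomes the Lyapunov equation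
  \<open>2 (\<Sigma> B + B \<Sigma>) = I - \<Sigma>\<close>, whose only symmetric solution is \<open>B = (\<Sigma>\<^sup>-\<^sup>1 - I) / 4\<close>. Substituting
  \<open>v = - \<Sigma>\<^sup>-\<^sup>1 (\<xi> / 2 + B x)\<close> into the continuity equation and using the identity once more gives
  the Fokker--Planck equation.\<close>

section \<open>Smooth functions and test functions\<close>

text \<open>The identity for \<xi> is the weak form of \<xi> = x + grad log \<rho>, with \<rho> the
  Lebesgue density of \<mu>. Keeping it in weak form avoids any differentiability of the density.
  Moving along one fixed direction e makes the Jacobian the scalar 1 + s
  \<partial>\<phi>/\<partial>e and turns injectivity into monotonicity along lines parallel to e;
  general test fields are recovered componentwise. Equality, not just an inequality, results because
  s may have either sign. The obstacle in solving for v is that the mobility operator is nonlocal: v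
  enters once pointwise and once through its own moment B. The moment identity is a closed equation
  for B alone, and once B is known the relation between \<xi> and v is pointwise. This is also where
  the factor 1/4 comes from. With R the inverse of \<Sigma>, v is -(1/2) R \<xi> - (1/4)(R R - R) x.
  The summand x of \<xi> contributes -(1/2) R x, and the two drifts add up to -(1/4)(R + R R) x,
  while grad log \<rho> produces the diffusion with matrix R/2.\<close>

lemma C_k_Suc_imp: "C_k (Suc k) f \<Longrightarrow> C_k k f"
proof (induction k arbitrary: f)
  case 0
  then show ?case
    by (auto intro!: continuous_at_imp_continuous_on differentiable_imp_continuous_within)
next
  case (Suc k)
  have "C_k k (\<lambda>x. frechet_derivative f (at x) h)" for h
    by (rule Suc.IH) (use Suc.prems in simp)
  then show ?case using Suc.prems by simp
qed

lemma C_k_const: "C_k k (\<lambda>x. c)"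
  by (induction k arbitrary: c) auto

lemma C_k_bounded_linear:
  assumes "bounded_linear f"
  shows "C_k k f"
proof -
  have D: "(f has_derivative f) (at x)" for x
    by (rule bounded_linear_imp_has_derivative[OF assms])
  show ?thesis
    using D by (cases k) (auto simp: linear_continuous_on[OF assms] C_k_const differentiable_def
      frechet_derivative_at[OF D, symmetric])
qed

lemma C_k_add: "C_k k f \<Longrightarrow> C_k k g \<Longrightarrow> C_k k (\<lambda>x. f x + g x)"
proof (induction k arbitrary: f g)
  case 0
  then show ?case by (auto intro: continuous_on_add)
next
  case (Suc k)
  then have d: "f differentiable (at x)" "g differentiable (at x)" for x by auto
  then have "((\<lambda>x. f x + g x) has_derivative
     (\<lambda>h. frechet_derivative f (at x) h + frechet_derivative g (at x) h)) (at x)" for x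
    by (intro has_derivative_add) (auto simp: frechet_derivative_works[symmetric])
  from frechet_derivative_at[OF this, symmetric] show ?case
    using d Suc by auto
qed

lemma C_k_mult:
  fixes f g :: "'a::euclidean_space \<Rightarrow> real"
  shows "C_k k f \<Longrightarrow> C_k k g \<Longrightarrow> C_k k (\<lambda>x. f x * g x)"
proof (induction k arbitrary: f g)
  case 0
  then show ?case by (auto intro: continuous_on_mult)
next
  case (Suc k)
  then have d: "f differentiable (at x)" "g differentiable (at x)" for x by auto
  then have "((\<lambda>x. f x * g x) has_derivative
     (\<lambda>h. f x * frechet_derivative g (at x) h + frechet_derivative f (at x) h * g x)) (at x)" for x
    by (intro has_derivative_mult) (auto simp: frechet_derivative_works[symmetric])
  note fd = frechet_derivative_at[OF this, symmetric]
  \<comment> \<open>The product rule leaves one factor undifferentiated in each summand; that factor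
    has to be lowered to order \<open>k\<close> before the induction hypothesis applies.\<close>
  have "C_k k f" "C_k k g" using Suc.prems by (auto intro: C_k_Suc_imp)
  then show ?case
    using d Suc by (auto simp: fd intro!: C_k_add)
qed

lemma C_k_scaleR_vector:
  fixes f :: "'a::euclidean_space \<Rightarrow> real"
  shows "C_k k f \<Longrightarrow> C_k k (\<lambda>x. f x *\<^sub>R e)"
proof (induction k arbitrary: f)
  case 0
  then show ?case by (auto intro: continuous_on_scaleR)
next
  case (Suc k)
  then have d: "f differentiable (at x)" for x by auto
  then have "((\<lambda>x. f x *\<^sub>R e) has_derivative (\<lambda>h. frechet_derivative f (at x) h *\<^sub>R e)) (at x)" for x
    by (intro has_derivative_scaleR_left) (auto simp: frechet_derivative_works[symmetric])
  from frechet_derivative_at[OF this, symmetric] show ?case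
    using d Suc by auto
qed

lemma frechet_derivative_affine:
  assumes "f differentiable (at (a + L x))" "bounded_linear L"
  shows "((\<lambda>x. f (a + L x)) has_derivative (\<lambda>h. frechet_derivative f (at (a + L x)) (L h))) (at x)"
proof -
  have "((\<lambda>x. a + L x) has_derivative L) (at x)"
    using has_derivative_add[OF has_derivative_const bounded_linear_imp_has_derivative[OF assms(2)]]
    by simp
  from diff_chain_at[OF this, of f] assms(1) show ?thesis
    by (auto simp: frechet_derivative_works o_def)
qed

text \<open>Serves two purposes: restricting a space-time function to a time slice, and dilating a
  cutoff function.\<close>

lemma C_k_affine:
  assumes "bounded_linear L"
  shows "C_k k f \<Longrightarrow> C_k k (\<lambda>x. f (a + L x))"
proof (induction k arbitrary: f)
  case 0
  have "continuous_on UNIV (\<lambda>x. a + L x)"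
    using assms by (intro continuous_intros linear_continuous_on)
  with 0 show ?case
    by (auto intro: continuous_on_compose2)
next
  case (Suc k)
  have D: "((\<lambda>x. f (a + L x)) has_derivative (\<lambda>h. frechet_derivative f (at (a + L x)) (L h))) (at x)" for x
    using Suc.prems by (intro frechet_derivative_affine assms) auto
  have "C_k k (\<lambda>x. frechet_derivative f (at (a + L x)) (L h))" for h
    by (rule Suc.IH) (use Suc.prems in auto)
  then show ?case
    using D by (auto simp: frechet_derivative_at[OF D, symmetric] differentiable_def)
qed

lemma test_functionsD:
  assumes "f \<in> test_functions U"
  shows test_functions_differentiable: "f differentiable (at x)"
    and test_functions_continuous: "continuous_on UNIV f"
    and test_functions_bounded: "bounded (range f)"
    and test_functions_UNIV: "f \<in> test_functions UNIV"
proof -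
  have C: "C_k k f" for k using assms by (auto simp: test_functions_def)
  show "f differentiable (at x)" using C[of "Suc 0"] by auto
  show cont: "continuous_on UNIV f" using C[of 0] by auto
  have "bounded (f ` closure {z. f z \<noteq> 0})"
    using assms by (intro compact_imp_bounded compact_continuous_image continuous_on_subset[OF cont])
       (auto simp: test_functions_def)
  then have "bounded (insert 0 (f ` closure {z. f z \<noteq> 0}))" by simp
  then show "bounded (range f)"
    by (rule bounded_subset) (use closure_subset[of "{z. f z \<noteq> 0}"] in force)
  show "f \<in> test_functions UNIV" using assms by (auto simp: test_functions_def)
qed

lemma test_functionsI:
  assumes "\<And>k. C_k k f" "bounded S" "\<And>x. f x \<noteq> 0 \<Longrightarrow> x \<in> S"
  shows "f \<in> test_functions UNIV"
proof -
  have "bounded {x. f x \<noteq> 0}" by (rule bounded_subset[OF assms(2)]) (use assms(3) in auto)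
  with assms(1) show ?thesis by (auto simp: test_functions_def compact_closure)
qed

lemma test_functions_C_k: "f \<in> test_functions U \<Longrightarrow> C_k k f"
  and test_functions_support: "f \<in> test_functions U \<Longrightarrow> bounded {x. f x \<noteq> 0}"
  by (auto simp: test_functions_def compact_closure)

lemma frechet_derivative_eq_0_outside:
  assumes "z \<notin> closure {z. f z \<noteq> 0}"
  shows "frechet_derivative f (at z) h = 0"
proof -
  have "(f has_derivative (\<lambda>_. 0)) (at z)"
  proof (rule has_derivative_transform_within_open[of "\<lambda>_. 0"])
    show "open (- closure {z. f z \<noteq> 0})" by auto
    show "z \<in> - closure {z. f z \<noteq> 0}" using assms by auto
    show "0 = f x" if "x \<in> - closure {z. f z \<noteq> 0}" for x
      using that closure_subset[of "{z. f z \<noteq> 0}"] by auto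
  qed auto
  from frechet_derivative_at[OF this, symmetric] show ?thesis by simp
qed

lemma test_functions_frechet_derivative:
  assumes "f \<in> test_functions UNIV"
  shows "(\<lambda>x. frechet_derivative f (at x) h) \<in> test_functions UNIV"
proof (rule test_functionsI)
  show "C_k k (\<lambda>x. frechet_derivative f (at x) h)" for k
    using test_functions_C_k[OF assms, of "Suc k"] by simp
  show "bounded (closure {z. f z \<noteq> 0})"
    using test_functions_support[OF assms] by (rule bounded_closure)
  show "x \<in> closure {z. f z \<noteq> 0}" if "frechet_derivative f (at x) h \<noteq> 0" for x
    using that frechet_derivative_eq_0_outside by blast
qed

lemma test_functions_slice:
  fixes \<phi> :: "real \<times> 'a::euclidean_space \<Rightarrow> real"
  assumes "\<phi> \<in> test_functions U"
  shows "(\<lambda>y. \<phi> (t, y)) \<in> test_functions UNIV"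
proof (rule test_functionsI)
  have bl: "bounded_linear (\<lambda>y::'a. (0::real, y))"
    by (intro bounded_linear_Pair bounded_linear_zero bounded_linear_ident)
  show "C_k k (\<lambda>y. \<phi> (t, y))" for k
    using C_k_affine[OF bl, of k \<phi> "(t, 0)"] test_functions_C_k[OF assms] by auto
  show "bounded (snd ` {z. \<phi> z \<noteq> 0})"
    by (intro bounded_snd test_functions_support[OF assms])
  show "x \<in> snd ` {z. \<phi> z \<noteq> 0}" if "\<phi> (t, x) \<noteq> 0" for x
    using that by (intro image_eqI[of _ _ "(t, x)"]) auto
qed

text \<open>Exhibits the time derivative as a directional derivative of \<phi>, so that it is a
  slice of a test function and hence integrable for every probability measure.\<close>

lemma deriv_time_slice:
  fixes \<phi> :: "real \<times> 'a::euclidean_space \<Rightarrow> real"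
  assumes "\<phi> \<in> test_functions U"
  shows "deriv (\<lambda>s. \<phi> (s, x)) t = frechet_derivative \<phi> (at (t, x)) (1, 0)"
proof -
  have bl': "bounded_linear (\<lambda>s::real. (s, 0::'a))"
    by (intro bounded_linear_Pair bounded_linear_zero bounded_linear_ident)
  have d: "\<phi> differentiable (at z)" for z by (rule test_functions_differentiable[OF assms])
  have "((\<lambda>s. \<phi> (s, x)) has_derivative (\<lambda>h. frechet_derivative \<phi> (at (t, x)) (h, 0))) (at t)"
    using frechet_derivative_affine[OF d bl', of "(0, x)" t] by simp
  moreover have "(\<lambda>h. frechet_derivative \<phi> (at (t, x)) (h, 0)) = (*) (frechet_derivative \<phi> (at (t, x)) (1, 0))"
  proof
    fix h
    show "frechet_derivative \<phi> (at (t, x)) (h, 0) = frechet_derivative \<phi> (at (t, x)) (1, 0) * h"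
      using linear_cmul[OF linear_frechet_derivative[OF d[of "(t, x)"]], of h "(1, 0)"]
      by (simp only: scaleR_Pair scaleR_zero_right real_scaleR_def mult_1_right mult.commute mult_1_left)
  qed
  ultimately have "((\<lambda>s. \<phi> (s, x)) has_real_derivative frechet_derivative \<phi> (at (t, x)) (1, 0)) (at t)"
    by (simp only: has_field_derivative_def)
  then show "deriv (\<lambda>s. \<phi> (s, x)) t = frechet_derivative \<phi> (at (t, x)) (1, 0)"
    by (rule DERIV_imp_deriv)
qed

lemma test_functions_scaleR_vector:
  fixes f :: "'a::euclidean_space \<Rightarrow> real"
  assumes "f \<in> test_functions UNIV"
  shows "(\<lambda>x. f x *\<^sub>R e) \<in> test_functions UNIV"
  using test_functions_support[OF assms]
  by (rule test_functionsI[rotated]) (auto intro: C_k_scaleR_vector test_functions_C_k[OF assms])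

lemma test_functions_mult_left:
  fixes f :: "'a::euclidean_space \<Rightarrow> real"
  assumes "f \<in> test_functions UNIV" "\<And>k. C_k k g"
  shows "(\<lambda>x. g x * f x) \<in> test_functions UNIV"
  using test_functions_support[OF assms(1)]
  by (rule test_functionsI[rotated]) (auto intro: C_k_mult assms(2) test_functions_C_k[OF assms(1)])

text \<open>This class contains \<open>exp (-1/s)\<close> and is closed under differentiation, which replaces
  \<open>p\<close> by \<open>X\<^sup>2 (p - p')\<close>.\<close>

definition exp_inv_poly :: "real poly \<Rightarrow> real \<Rightarrow> real" where
  "exp_inv_poly p s = (if s > 0 then poly p (1 / s) * exp (- 1 / s) else 0)"

text \<open>With x = 1/s this is the domination of every polynomial by the exponential at
  infinity.\<close>

lemma exp_inv_poly_tendsto_0: "((exp_inv_poly p) \<longlongrightarrow> 0) (at_right 0)"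
proof -
  have "((\<lambda>x. poly p x / exp x) \<longlongrightarrow> 0) at_top"
  proof -
    have "((\<lambda>x. x ^ i / exp x :: real) \<longlongrightarrow> 0) at_top" for i
      by (rule tendsto_power_div_exp_0)
    then have "((\<lambda>x. \<Sum>i\<le>degree p. coeff p i * (x ^ i / exp x)) \<longlongrightarrow> 0) at_top"
      by (intro tendsto_null_sum tendsto_mult_right_zero)
    then show ?thesis by (simp add: poly_altdef sum_divide_distrib)
  qed
  from filterlim_compose[OF this filterlim_inverse_at_top_right]
  have "((\<lambda>x. poly p (inverse x) / exp (inverse x)) \<longlongrightarrow> 0) (at_right 0)" .
  then show ?thesis
    by (rule Lim_transform_eventually)
      (auto simp: eventually_at_right_field exp_inv_poly_def exp_minus field_simps intro!: exI[of _ 1])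
qed

lemma exp_inv_poly_deriv:
  "(exp_inv_poly p has_real_derivative exp_inv_poly ([:0, 0, 1:] * (p - pderiv p)) s) (at s)"
proof -
  consider "s > 0" | "s < 0" | "s = 0" by linarith
  then show ?thesis
  proof cases
    case 1
    have "((\<lambda>s. poly p (1 / s) * exp (- 1 / s)) has_real_derivative
       exp_inv_poly ([:0, 0, 1:] * (p - pderiv p)) s) (at s)"
    proof -
      have "((\<lambda>s. 1 / s) has_real_derivative - (1 / s)\<^sup>2) (at s)"
        using 1 by (auto intro!: derivative_eq_intros simp: power2_eq_square)
      then have "((\<lambda>s. poly p (1 / s) * exp (- (1 / s))) has_real_derivative
          poly (pderiv p) (1 / s) * (- (1 / s)\<^sup>2) * exp (- (1 / s)) +
          exp (- (1 / s)) * (- (- (1 / s)\<^sup>2)) * poly p (1 / s)) (at s)"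
        by (intro DERIV_mult DERIV_chain2[OF poly_DERIV] DERIV_chain2[OF DERIV_exp] DERIV_minus)
      then show ?thesis
        using 1 by (simp add: exp_inv_poly_def power2_eq_square algebra_simps)
    qed
    then show ?thesis
      by (rule has_field_derivative_transform_within_open[where S = "{0<..}"])
        (use 1 in \<open>auto simp: exp_inv_poly_def\<close>)
  next
    case 2
    have "((\<lambda>s. 0) has_real_derivative exp_inv_poly ([:0, 0, 1:] * (p - pderiv p)) s) (at s)"
      using 2 by (auto simp: exp_inv_poly_def)
    then show ?thesis
      by (rule has_field_derivative_transform_within_open[where S = "{..<0}"])
        (use 2 in \<open>auto simp: exp_inv_poly_def\<close>)
  next
    case 3
    \<comment> \<open>Dividing by h multiplies the polynomial in 1/h by its variable, so the
      difference quotient at 0 is again a function of this class and tends to 0.\<close>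
    have "((\<lambda>h. exp_inv_poly p h / h) \<longlongrightarrow> 0) (at_right 0)"
      by (rule Lim_transform_eventually[OF exp_inv_poly_tendsto_0[of "[:0,1:] * p"]])
        (auto simp: eventually_at_right_field exp_inv_poly_def intro!: exI[of _ 1])
    moreover have "((\<lambda>h. exp_inv_poly p h / h) \<longlongrightarrow> 0) (at_left 0)"
      by (rule Lim_transform_eventually[OF tendsto_const])
        (auto simp: eventually_at_left_field exp_inv_poly_def intro!: exI[of _ "-1"])
    ultimately have "((\<lambda>h. exp_inv_poly p h / h) \<longlongrightarrow> 0) (at 0)"
      by (intro filterlim_split_at)
    moreover have "exp_inv_poly r 0 = 0" for r
      by (simp add: exp_inv_poly_def)
    ultimately show ?thesis
      unfolding 3 DERIV_def by (simp only: add_0 diff_0_right)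
  qed
qed

text \<open>The derivative has the same shape with another polynomial, times a derivative of
  \<open>q\<close>; hence the induction on \<open>k\<close> is over all \<open>p\<close> at
  once.\<close>

lemma C_k_exp_inv_poly_comp:
  fixes q :: "'a::euclidean_space \<Rightarrow> real"
  assumes q: "\<And>k. C_k k q"
  shows "C_k k (\<lambda>x. exp_inv_poly p (q x))"
proof -
  have qd: "q differentiable (at x)" for x using q[of "Suc 0"] by auto
  have D: "((\<lambda>x. exp_inv_poly p (q x)) has_derivative
     (\<lambda>h. exp_inv_poly ([:0, 0, 1:] * (p - pderiv p)) (q x) * frechet_derivative q (at x) h)) (at x)"
    for p x
    using qd diff_chain_at[of q "frechet_derivative q (at x)" x "exp_inv_poly p"]
      exp_inv_poly_deriv[of p "q x"]
    by (simp add: has_field_derivative_def frechet_derivative_works o_def)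
  show ?thesis
  proof (induction k arbitrary: p)
    case 0
    have "continuous (at x) (\<lambda>x. exp_inv_poly p (q x))" for x
      by (rule has_derivative_continuous[OF D])
    then show ?case by (auto intro: continuous_at_imp_continuous_on)
  next
    case (Suc k)
    have "C_k k (\<lambda>x. frechet_derivative q (at x) h)" for h
      using q[of "Suc k"] by simp
    then show ?case
      using D Suc by (auto simp: frechet_derivative_at[OF D, symmetric] differentiable_def intro!: C_k_mult)
  qed
qed

lemma bump_exists:
  obtains \<eta> :: "'a::euclidean_space \<Rightarrow> real" where "\<eta> \<in> test_functions UNIV" "\<eta> 0 = 1"
proof
  define q :: "'a \<Rightarrow> real" where "q = (\<lambda>x. 1 - x \<bullet> x)"
  \<comment> \<open>The standard bump exp (-1 / (1 - |x|^2)) on the unit ball; the factor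
    \<open>exp 1\<close> normalises its value at 0.\<close>
  define \<eta> where "\<eta> x = exp 1 * exp_inv_poly 1 (q x)" for x
  have "C_k k (\<lambda>x::'a. x \<bullet> x)" for k
  proof -
    have D: "((\<lambda>x::'a. x \<bullet> x) has_derivative (\<lambda>h. 2 * (x \<bullet> h))) (at x)" for x
      by (auto intro!: derivative_eq_intros simp: inner_commute)
    have "C_k n (\<lambda>x::'a. 2 * (x \<bullet> h))" for n h
      by (rule C_k_bounded_linear) (intro bounded_linear_const_mult bounded_linear_inner_left)
    then show ?thesis
      using D by (cases k) (auto simp: frechet_derivative_at[OF D, symmetric] differentiable_def
         intro!: continuous_intros)
  qed
  then have "C_k k q" for k
    using C_k_add[OF C_k_const[of k 1] C_k_mult[OF C_k_const[of k "-1"]], of "\<lambda>x::'a. x \<bullet> x"]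
    by (simp add: q_def)
  then have "C_k k \<eta>" for k
    unfolding \<eta>_def[abs_def] by (intro C_k_mult C_k_const C_k_exp_inv_poly_comp)
  moreover have "x \<in> cball 0 1" if "\<eta> x \<noteq> 0" for x
    using that by (auto simp: \<eta>_def exp_inv_poly_def q_def dot_square_norm abs_square_less_1 split: if_splits)
  then have "bounded {x. \<eta> x \<noteq> 0}"
    by (intro bounded_subset[OF bounded_cball[of 0 1]]) auto
  ultimately show "\<eta> \<in> test_functions UNIV"
    by (auto simp: test_functions_def compact_closure)
  show "\<eta> 0 = 1" by (simp add: \<eta>_def exp_inv_poly_def q_def exp_add[symmetric])
qed

section \<open>Change of variables for shears\<close>

lemma nn_integral_lborel_translate:
  fixes f :: "'a::euclidean_space \<Rightarrow> ennreal"
  assumes "f \<in> borel_measurable borel"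
  shows "(\<integral>\<^sup>+x. f (x + a) \<partial>lborel) = (\<integral>\<^sup>+x. f x \<partial>lborel)"
proof -
  have "(\<integral>\<^sup>+x. f x \<partial>lborel) = (\<integral>\<^sup>+x. f x \<partial>distr lborel borel ((+) a))"
    by (simp add: lborel_distr_plus)
  also have "\<dots> = (\<integral>\<^sup>+x. f (a + x) \<partial>lborel)"
    using assms by (subst nn_integral_distr) auto
  finally show ?thesis by (simp add: add.commute)
qed

text \<open>\<tau> is strictly increasing and stays within \<open>C\<close> of the identity, so it
  changes sign between \<open>- C\<close> and \<open>C\<close> and its only zero separates the two
  signs.\<close>

lemma strict_mono_bounded_perturbation_zero:
  fixes \<tau> :: "real \<Rightarrow> real"
  assumes "\<And>r. (\<tau> has_real_derivative \<tau>' r) (at r)" "\<And>r. 0 < \<tau>' r" "\<And>r. \<bar>\<tau> r - r\<bar> \<le> C"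
  obtains r0 where "\<And>r. \<tau> r \<le> 0 \<longleftrightarrow> r \<le> r0" "\<And>r. 0 \<le> \<tau> r \<longleftrightarrow> r0 \<le> r"
proof -
  have mono: "\<tau> r < \<tau> s" if "r < s" for r s
    by (rule DERIV_pos_imp_increasing[OF that]) (use assms in blast)
  have "\<tau> (- C) \<le> 0" "0 \<le> \<tau> C" "- C \<le> C"
    using assms(3)[of C] assms(3)[of "- C"] by (auto simp: abs_le_iff)
  moreover have "continuous_on {- C..C} \<tau>"
    by (rule DERIV_continuous_on[OF has_field_derivative_at_within[OF assms(1)]])
  ultimately obtain r0 where r0: "\<tau> r0 = 0"
    using IVT'[of \<tau> "- C" 0 C] by auto
  show ?thesis
  proof (rule that[of r0])
    show "\<tau> r \<le> 0 \<longleftrightarrow> r \<le> r0" "0 \<le> \<tau> r \<longleftrightarrow> r0 \<le> r" for r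
      using mono[of r r0] mono[of r0 r] r0 by (cases r r0 rule: linorder_cases; simp)+
  qed
qed

lemma measurable_pred_mem_atLeastAtMost [measurable (raw)]:
  fixes a b c :: "'a \<Rightarrow> real"
  assumes [measurable]: "a \<in> borel_measurable M" "b \<in> borel_measurable M" "c \<in> borel_measurable M"
  shows "Measurable.pred M (\<lambda>x. c x \<in> {a x..b x})"
  unfolding atLeastAtMost_iff by measurable

lemma shear_line_deriv:
  fixes \<phi> d :: "'a::euclidean_space \<Rightarrow> real" and e :: 'a
  assumes "\<And>x. ((\<lambda>r. \<phi> (x + r *\<^sub>R e)) has_real_derivative d x) (at 0)"
  shows "((\<lambda>r. r + \<phi> (x + r *\<^sub>R e)) has_real_derivative 1 + d (x + r *\<^sub>R e)) (at r)"
proof -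
  have "((\<lambda>h. \<phi> (x + (r + h) *\<^sub>R e)) has_real_derivative d (x + r *\<^sub>R e)) (at 0)"
    using assms[of "x + r *\<^sub>R e"] by (simp add: scaleR_add_left add.assoc)
  then have "((\<lambda>r. \<phi> (x + r *\<^sub>R e)) has_real_derivative d (x + r *\<^sub>R e)) (at r)"
    using DERIV_shift[of "\<lambda>r. \<phi> (x + r *\<^sub>R e)" _ 0 r] by (simp add: add.commute)
  from DERIV_add[OF DERIV_ident this] show ?thesis .
qed

text \<open>Two points with the same image differ by a multiple of \<open>e\<close>. On the line
  through them the shear acts as a function with positive derivative, so they coincide.\<close>

lemma inj_shear:
  fixes \<phi> d :: "'a::euclidean_space \<Rightarrow> real" and e :: 'a
  assumes deriv: "\<And>x. ((\<lambda>r. \<phi> (x + r *\<^sub>R e)) has_real_derivative d x) (at 0)"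
    and pos: "\<And>x. 0 < 1 + d x"
  shows "inj (\<lambda>x. x + \<phi> x *\<^sub>R e)"
proof (rule injI)
  fix x y assume eq: "x + \<phi> x *\<^sub>R e = y + \<phi> y *\<^sub>R e"
  define a where "a = \<phi> x - \<phi> y"
  have y: "y = x + a *\<^sub>R e"
    using eq by (simp add: a_def algebra_simps)
  let ?\<tau> = "\<lambda>r. r + \<phi> (x + r *\<^sub>R e)"
  have mono: "?\<tau> r < ?\<tau> s" if "r < s" for r s
    by (rule DERIV_pos_imp_increasing[OF that]) (use pos shear_line_deriv[of \<phi> e d, OF deriv] in blast)
  have "?\<tau> a = ?\<tau> 0" using y by (simp add: a_def)
  then have "a = 0" using mono[of a 0] mono[of 0 a] by (cases a "0::real" rule: linorder_cases) auto
  then show "x = y" using y by simp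
qed

text \<open>By invariance of domain the range is open and the inverse is continuous there, so
  extending it by 0 keeps it Borel.\<close>

lemma continuous_inj_borel_left_inverse:
  fixes T :: "'a::euclidean_space \<Rightarrow> 'a"
  assumes "continuous_on UNIV T" "inj T"
  obtains S where "S \<in> borel_measurable borel" "\<And>x. S (T x) = x"
proof -
  obtain g where g: "homeomorphism UNIV (range T) T g"
    using invariance_of_domain_homeomorphism[of UNIV T] assms by auto
  have "open (range T)" using invariance_of_domain[of UNIV T] assms by auto
  then have "(\<lambda>y. if y \<in> range T then g y else 0) \<in> borel_measurable borel"
    using g by (intro borel_measurable_continuous_on_if) (auto simp: homeomorphism_def)
  then show thesis
    by (rule that) (use g in \<open>auto simp: homeomorphism_def\<close>)
qed

text \<open>The library's change of variables needs a well-ordered index type. For a shear, averaging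
  over the translates by \<open>r e\<close>, \<open>0 \<le> r \<le> 1\<close>, reduces the claim to the one-dimensional
  substitution rule.\<close>

lemma distr_shear_lborel:
  fixes \<phi> d :: "'a::euclidean_space \<Rightarrow> real" and e :: 'a
  assumes [measurable]: "\<phi> \<in> borel_measurable borel"
    and cd: "continuous_on UNIV d"
    and deriv: "\<And>x. ((\<lambda>r. \<phi> (x + r *\<^sub>R e)) has_real_derivative d x) (at 0)"
    and pos: "\<And>x. 0 < 1 + d x"
    and bdd: "\<And>x. \<bar>\<phi> x\<bar> \<le> C"
  shows "distr (density lborel (\<lambda>x. ennreal (1 + d x))) borel (\<lambda>x. x + \<phi> x *\<^sub>R e) = lborel"
proof (rule measure_eqI)
  let ?T = "\<lambda>x. x + \<phi> x *\<^sub>R e"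
  fix B assume "B \<in> sets (distr (density lborel (\<lambda>x. ennreal (1 + d x))) borel ?T)"
  then have B[measurable]: "B \<in> sets borel" by simp
  have [measurable]: "d \<in> borel_measurable borel"
    by (rule borel_measurable_continuous_onI[OF cd])
  define g where "g x = ennreal (1 + d x) * indicator B (?T x)" for x
  have [measurable]: "g \<in> borel_measurable borel" unfolding g_def by measurable
  note D = shear_line_deriv[of \<phi> e d, OF deriv]
  \<comment> \<open>Substitution of u = r + \<phi> (x + r e) on the line through \<open>x\<close>:
    the density 1 + d is exactly the derivative of u, and the endpoints r = 0, 1 go to \<phi> x and
    1 + \<phi> (x + e).\<close>
  have sub: "(\<integral>\<^sup>+r. indicator {0..1::real} r * g (x + r *\<^sub>R e) \<partial>lborel) =
      (\<integral>\<^sup>+u. indicator B (x + u *\<^sub>R e) * indicator {\<phi> x..1 + \<phi> (x + e)} u \<partial>lborel)" for x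
  proof -
    let ?f = "\<lambda>u. indicator B (x + u *\<^sub>R e) :: real" and ?\<tau> = "\<lambda>r. r + \<phi> (x + r *\<^sub>R e)"
    have "(\<integral>\<^sup>+u. ennreal (?f u * indicator {?\<tau> 0..?\<tau> 1} u) \<partial>lborel) =
      (\<integral>\<^sup>+r. ennreal (?f (?\<tau> r) * (1 + d (x + r *\<^sub>R e)) * indicator {0..1} r) \<partial>lborel)"
      by (rule nn_integral_substitution[OF _ D])
        (use pos cd in \<open>auto simp: set_borel_measurable_def less_imp_le
          intro!: continuous_intros continuous_on_compose2[OF cd]\<close>)
    also have "\<dots> = (\<integral>\<^sup>+r. indicator {0..1::real} r * g (x + r *\<^sub>R e) \<partial>lborel)"
      by (intro nn_integral_cong)
        (auto simp: g_def indicator_def scaleR_add_left add.assoc split: if_splits)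
    also have "(\<integral>\<^sup>+u. ennreal (?f u * indicator {?\<tau> 0..?\<tau> 1} u) \<partial>lborel) =
      (\<integral>\<^sup>+u. indicator B (x + u *\<^sub>R e) * indicator {\<phi> x..1 + \<phi> (x + e)} u \<partial>lborel)"
      by (intro nn_integral_cong) (auto simp: indicator_def)
    finally show ?thesis by simp
  qed
  \<comment> \<open>Let \<tau> r = r + \<phi> (x + r e). Membership of u means \<tau> (- u) \<le> 0
    \<le> \<tau> (1 - u). With \<open>r0\<close> the zero of \<tau> this is the interval from - r0
    to 1 - r0, whose length is 1 whatever \<phi> is.\<close>
  have len: "(\<integral>\<^sup>+u. indicator {\<phi> (x - u *\<^sub>R e)..1 + \<phi> (x - u *\<^sub>R e + e)} u \<partial>lborel) = 1" for x
  proof -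
    have "\<And>r. \<bar>(r + \<phi> (x + r *\<^sub>R e)) - r\<bar> \<le> C" using bdd by simp
    then obtain r0 where r0: "\<And>r. r + \<phi> (x + r *\<^sub>R e) \<le> 0 \<longleftrightarrow> r \<le> r0"
        "\<And>r. 0 \<le> r + \<phi> (x + r *\<^sub>R e) \<longleftrightarrow> r0 \<le> r"
      using strict_mono_bounded_perturbation_zero[OF D] pos by blast
    have "u \<in> {\<phi> (x - u *\<^sub>R e)..1 + \<phi> (x - u *\<^sub>R e + e)} \<longleftrightarrow> u \<in> {- r0..1 - r0}" for u
    proof -
      have eq: "x - u *\<^sub>R e = x + (- u) *\<^sub>R e" "x - u *\<^sub>R e + e = x + (1 - u) *\<^sub>R e"
        by (simp_all add: algebra_simps)
      show ?thesis
        unfolding eq(2) unfolding eq(1) using r0(1)[of "- u"] r0(2)[of "1 - u"] by auto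
    qed
    then have "(\<integral>\<^sup>+u. indicator {\<phi> (x - u *\<^sub>R e)..1 + \<phi> (x - u *\<^sub>R e + e)} u \<partial>lborel) =
      (\<integral>\<^sup>+u. indicator {- r0..1 - r0} u \<partial>lborel)"
      by (intro nn_integral_cong) (simp add: indicator_def)
    also have "\<dots> = 1" by simp
    finally show ?thesis .
  qed
  have "emeasure (distr (density lborel (\<lambda>x. ennreal (1 + d x))) borel ?T) B = (\<integral>\<^sup>+x. g x \<partial>lborel)"
    by (simp add: emeasure_distr emeasure_density g_def indicator_def vimage_def)
  \<comment> \<open>The averaging over translates: each inner integral equals the untranslated one,
    and the unit interval has mass 1.\<close>
  also have "\<dots> = (\<integral>\<^sup>+r. indicator {0..1::real} r * (\<integral>\<^sup>+x. g (x + r *\<^sub>R e) \<partial>lborel) \<partial>lborel)"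
    by (simp add: nn_integral_lborel_translate nn_integral_multc)
  also have "\<dots> = (\<integral>\<^sup>+r. (\<integral>\<^sup>+x. indicator {0..1::real} r * g (x + r *\<^sub>R e) \<partial>lborel) \<partial>lborel)"
    by (intro nn_integral_cong nn_integral_cmult[symmetric]) measurable
  also have "\<dots> = (\<integral>\<^sup>+x. (\<integral>\<^sup>+r. indicator {0..1::real} r * g (x + r *\<^sub>R e) \<partial>lborel) \<partial>lborel)"
    by (rule lborel_pair.Fubini') measurable
  also have "\<dots> = (\<integral>\<^sup>+x. (\<integral>\<^sup>+u. indicator B (x + u *\<^sub>R e) * indicator {\<phi> x..1 + \<phi> (x + e)} u \<partial>lborel) \<partial>lborel)"
    by (simp add: sub)
  also have "\<dots> = (\<integral>\<^sup>+u. (\<integral>\<^sup>+x. indicator B (x + u *\<^sub>R e) * indicator {\<phi> x..1 + \<phi> (x + e)} u \<partial>lborel) \<partial>lborel)"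
    by (rule lborel_pair.Fubini'[symmetric]) measurable
  also have "\<dots> = (\<integral>\<^sup>+u. (\<integral>\<^sup>+x. indicator B x *
      indicator {\<phi> (x - u *\<^sub>R e)..1 + \<phi> (x - u *\<^sub>R e + e)} u \<partial>lborel) \<partial>lborel)"
  proof (rule nn_integral_cong)
    fix u :: real
    show "(\<integral>\<^sup>+x. indicator B (x + u *\<^sub>R e) * indicator {\<phi> x..1 + \<phi> (x + e)} u \<partial>lborel) =
      (\<integral>\<^sup>+x. indicator B x * indicator {\<phi> (x - u *\<^sub>R e)..1 + \<phi> (x - u *\<^sub>R e + e)} u \<partial>lborel)"
      by (subst nn_integral_lborel_translate[where a = "u *\<^sub>R e", symmetric]) simp_all
  qed
  also have "\<dots> = (\<integral>\<^sup>+x. (\<integral>\<^sup>+u. indicator B x *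
      indicator {\<phi> (x - u *\<^sub>R e)..1 + \<phi> (x - u *\<^sub>R e + e)} u \<partial>lborel) \<partial>lborel)"
    by (rule lborel_pair.Fubini') measurable
  also have "\<dots> = (\<integral>\<^sup>+x. indicator B x \<partial>lborel)"
    by (intro nn_integral_cong) (simp add: nn_integral_cmult len)
  also have "\<dots> = emeasure lborel B" by simp
  finally show "emeasure (distr (density lborel (\<lambda>x. ennreal (1 + d x))) borel ?T) B = emeasure lborel B" .
qed simp

section \<open>Entropy of push-forwards\<close>

text \<open>Radon-Nikodym derivatives are unique a.e., so the log-density may be computed from any
  real representative \<open>f\<close>. The equality holds a.e. for the reference measure and passes
  to the density measure by absolute continuity.\<close>

lemma relative_entropy_density:
  assumes "sigma_finite_measure \<nu>" and [measurable]: "f \<in> borel_measurable \<nu>" and nn: "\<And>x. 0 \<le> f x"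
  shows "relative_entropy (density \<nu> (\<lambda>x. ennreal (f x))) \<nu> =
    (if integrable (density \<nu> (\<lambda>x. ennreal (f x))) (\<lambda>x. ln (f x))
     then ereal (\<integral>x. ln (f x) \<partial>density \<nu> (\<lambda>x. ennreal (f x))) else \<infinity>)"
proof -
  interpret sigma_finite_measure \<nu> by fact
  let ?\<mu> = "density \<nu> (\<lambda>x. ennreal (f x))"
  have ac: "absolutely_continuous \<nu> ?\<mu>" by (rule absolutely_continuousI_density) simp
  have "AE x in \<nu>. ennreal (f x) = RN_deriv \<nu> ?\<mu> x"
    by (rule RN_deriv_unique) auto
  then have "AE x in \<nu>. entropy_density (exp 1) \<nu> ?\<mu> x = ln (f x)"
  proof eventually_elim
    case (elim x)
    then show ?case using nn[of x] elim[symmetric] by (simp add: entropy_density_def log_def)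
  qed
  then have AE: "AE x in ?\<mu>. entropy_density (exp 1) \<nu> ?\<mu> x = ln (f x)"
    by (intro absolutely_continuous_AE[OF _ ac]) auto
  have "integrable ?\<mu> (entropy_density (exp 1) \<nu> ?\<mu>) \<longleftrightarrow> integrable ?\<mu> (\<lambda>x. ln (f x))"
    by (intro integrable_cong_AE AE) auto
  moreover have "KL_divergence (exp 1) \<nu> ?\<mu> = (\<integral>x. ln (f x) \<partial>?\<mu>)"
    unfolding KL_divergence_def by (intro integral_cong_AE AE) auto
  ultimately show ?thesis using ac by (simp add: relative_entropy_def)
qed

text \<open>The derivative of a finite measure is finite a.e. and so has a real representative. Its
  positivity a.e. for \<mu> is what later allows the logarithm of a product to be split.\<close>

lemma relative_entropy_finiteE:
  assumes "sigma_finite_measure \<nu>" "prob_space \<mu>" "sets \<mu> = sets \<nu>" "relative_entropy \<mu> \<nu> < \<infinity>"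
  obtains D where "D \<in> borel_measurable \<nu>" "\<And>x. 0 \<le> D x" "\<mu> = density \<nu> (\<lambda>x. ennreal (D x))"
    "AE x in \<mu>. 0 < D x" "integrable \<mu> (\<lambda>x. ln (D x))"
    "relative_entropy \<mu> \<nu> = ereal (\<integral>x. ln (D x) \<partial>\<mu>)"
proof -
  interpret sigma_finite_measure \<nu> by fact
  interpret \<mu>: prob_space \<mu> by fact
  have ac: "absolutely_continuous \<nu> \<mu>"
    using assms(4) by (auto simp: relative_entropy_def split: if_splits)
  obtain D where D: "D \<in> borel_measurable \<nu>" "AE x in \<nu>. RN_deriv \<nu> \<mu> x = ennreal (D x)"
      "AE x in \<mu>. 0 < D x" "\<And>x. 0 \<le> D x"
    using real_RN_deriv[OF \<mu>.finite_measure_axioms ac] assms(3) by blast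
  have "\<mu> = density \<nu> (RN_deriv \<nu> \<mu>)"
    using ac assms(3) by (intro density_RN_deriv[symmetric]) auto
  also have "\<dots> = density \<nu> (\<lambda>x. ennreal (D x))"
    using D by (intro density_cong) auto
  finally have \<mu>: "\<mu> = density \<nu> (\<lambda>x. ennreal (D x))" .
  have "relative_entropy \<mu> \<nu> = (if integrable \<mu> (\<lambda>x. ln (D x)) then ereal (\<integral>x. ln (D x) \<partial>\<mu>) else \<infinity>)"
    using relative_entropy_density[OF assms(1) D(1,4)] \<mu> by simp
  with assms(4) D \<mu> that show thesis by (auto split: if_splits)
qed

text \<open>The constant is left abstract because only quotients of Gaussian densities occur later,
  where it cancels.\<close>

lemma std_gaussian_eq:
  obtains c where "0 < c"
    "(std_gaussian :: (real^'n) measure) = density lborel (\<lambda>x. ennreal (c * exp (- (norm x)\<^sup>2 / 2)))"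
proof
  let ?c = "(1 / sqrt (2 * pi)) ^ CARD('n)"
  show "0 < ?c" by simp
  have "(\<Prod>i\<in>UNIV. std_normal_density (x $ i)) = ?c * exp (- (norm x)\<^sup>2 / 2)" for x :: "real^'n"
  proof -
    have "(norm x)\<^sup>2 = (\<Sum>i\<in>UNIV. (x $ i)\<^sup>2)"
      unfolding power2_norm_eq_inner inner_vec_def by (simp add: power2_eq_square)
    then have "exp (- (norm x)\<^sup>2 / 2) = (\<Prod>i\<in>UNIV. exp (- (x $ i)\<^sup>2 / 2))"
      by (simp add: exp_sum[symmetric] sum_negf sum_divide_distrib)
    then show ?thesis
      unfolding std_normal_density_def prod.distrib by simp
  qed
  then show "(std_gaussian :: (real^'n) measure) = density lborel (\<lambda>x. ennreal (?c * exp (- (norm x)\<^sup>2 / 2)))"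
    unfolding std_gaussian_def by simp
qed

lemma sigma_finite_std_gaussian: "sigma_finite_measure std_gaussian"
  unfolding std_gaussian_def
  by (subst sigma_finite_measure.sigma_finite_iff_density_finite[OF sigma_finite_lborel]) auto

lemma sets_std_gaussian [simp, measurable_cong]: "sets std_gaussian = sets borel"
  by (simp add: std_gaussian_def)

text \<open>At \<open>T x\<close> the push-forward has Gaussian density
  \<open>D x * G x / (G (T x) * J x)\<close>, and the logarithm of the factor multiplying
  \<open>D x\<close> is the added integrand. The hypothesis \<open>cov\<close> encodes that
  \<open>J\<close> is the Jacobian of \<open>T\<close> and that \<open>T\<close> covers almost all
  of the space; \<open>S\<close> expresses the density in terms of the image point.\<close>

lemma gaussian_entropy_distr:
  fixes \<mu> :: "(real^'n) measure" and T S :: "real^'n \<Rightarrow> real^'n" and J :: "real^'n \<Rightarrow> real"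
  assumes "prob_space \<mu>" and sets: "sets \<mu> = sets borel" and fin: "gaussian_entropy \<mu> < \<infinity>"
    and [measurable]: "T \<in> borel_measurable borel" "S \<in> borel_measurable borel" "J \<in> borel_measurable borel"
    and ST: "\<And>x. S (T x) = x" and J: "\<And>x. 0 < J x"
    and cov: "distr (density lborel (\<lambda>x. ennreal (J x))) borel T = lborel"
    and int: "integrable \<mu> (\<lambda>x. ((norm (T x))\<^sup>2 - (norm x)\<^sup>2) / 2 - ln (J x))"
  shows "gaussian_entropy (distr \<mu> borel T) =
    gaussian_entropy \<mu> + ereal (\<integral>x. ((norm (T x))\<^sup>2 - (norm x)\<^sup>2) / 2 - ln (J x) \<partial>\<mu>)"
proof -
  note [measurable_cong] = sets
  obtain c where c: "0 < c"
    and \<gamma>: "(std_gaussian :: (real^'n) measure) = density lborel (\<lambda>x. ennreal (c * exp (- (norm x)\<^sup>2 / 2)))"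
    by (rule std_gaussian_eq)
  define G where "G x = c * exp (- (norm x)\<^sup>2 / 2)" for x :: "real^'n"
  have [measurable]: "G \<in> borel_measurable borel" unfolding G_def by measurable
  have G: "0 < G x" for x using c by (simp add: G_def)
  have \<gamma>: "(std_gaussian :: (real^'n) measure) = density lborel (\<lambda>x. ennreal (G x))"
    unfolding \<gamma> G_def ..
  obtain D where D': "D \<in> borel_measurable std_gaussian" and D: "\<And>x. 0 \<le> D x"
      "\<mu> = density std_gaussian (\<lambda>x. ennreal (D x))" "AE x in \<mu>. 0 < D x" "integrable \<mu> (\<lambda>x. ln (D x))"
      "gaussian_entropy \<mu> = ereal (\<integral>x. ln (D x) \<partial>\<mu>)"
    using relative_entropy_finiteE[OF sigma_finite_std_gaussian \<open>prob_space \<mu>\<close>] fin sets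
    unfolding gaussian_entropy_def by (metis sets_std_gaussian)
  have [measurable]: "D \<in> borel_measurable borel"
    using D' by (simp cong: measurable_cong_sets)
  define q where "q x = G x / (G (T x) * J x)" for x
  have [measurable]: "q \<in> borel_measurable borel" unfolding q_def by measurable
  have q: "0 < q x" for x using G J by (simp add: q_def)
  define f where "f y = D (S y) * q (S y)" for y
  have [measurable]: "f \<in> borel_measurable borel" unfolding f_def by measurable
  have f: "0 \<le> f y" for y using D(1) q by (simp add: f_def less_imp_le)
  \<comment> \<open>Lebesgue measure is written as a push-forward under \<open>T\<close> by
    \<open>cov\<close>, so that densities can be pulled back to the source side.\<close>
  have "density std_gaussian (\<lambda>x. ennreal (f x)) =
      density (distr (density lborel (\<lambda>x. ennreal (J x))) borel T) (\<lambda>y. ennreal (G y) * ennreal (f y))"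
    unfolding \<gamma> cov by (subst density_density_eq) auto
  also have "\<dots> = distr (density (density lborel (\<lambda>x. ennreal (J x)))
      (\<lambda>x. ennreal (G (T x)) * ennreal (f (T x)))) borel T"
    by (subst density_distr) auto
  also have "\<dots> = distr (density lborel (\<lambda>x. ennreal (J x) * (ennreal (G (T x)) * ennreal (f (T x))))) borel T"
    by (subst density_density_eq) auto
  also have "(\<lambda>x. ennreal (J x) * (ennreal (G (T x)) * ennreal (f (T x)))) = (\<lambda>x. ennreal (G x) * ennreal (D x))"
  proof
    fix x
    have "J x * (G (T x) * f (T x)) = G x * D x"
      using J[of x] G[of "T x"] by (simp add: f_def ST q_def)
    then show "ennreal (J x) * (ennreal (G (T x)) * ennreal (f (T x))) = ennreal (G x) * ennreal (D x)"
      using J G f D(1) by (simp add: ennreal_mult[symmetric] less_imp_le)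
  qed
  also have "distr (density lborel (\<lambda>x. ennreal (G x) * ennreal (D x))) borel T = distr \<mu> borel T"
    unfolding D(2) \<gamma> by (subst density_density_eq) auto
  finally have \<nu>: "density std_gaussian (\<lambda>x. ennreal (f x)) = distr \<mu> borel T" .
  let ?h = "\<lambda>x. ((norm (T x))\<^sup>2 - (norm x)\<^sup>2) / 2 - ln (J x)"
  have ln_q: "ln (q x) = ?h x" for x
  proof -
    have "ln (q x) = ln (G x) - (ln (G (T x)) + ln (J x))"
      using G[of x] G[of "T x"] J[of x] by (simp add: q_def ln_div ln_mult)
    moreover have "ln (G y) = ln c - (norm y)\<^sup>2 / 2" for y
      using c by (simp add: G_def ln_mult)
    ultimately show ?thesis by (simp add: diff_divide_distrib)
  qed
  have AE: "AE x in \<mu>. ln (f (T x)) = ln (D x) + ?h x"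
    using D(3)
  proof eventually_elim
    case (elim x)
    then show ?case using q[of x] by (simp add: f_def ST ln_mult ln_q)
  qed
  have int_sum: "integrable \<mu> (\<lambda>x. ln (D x) + ?h x)" using D(4) int by simp
  have "integrable \<mu> (\<lambda>x. ln (f (T x)))"
    by (subst integrable_cong_AE[OF _ _ AE]) (use int_sum in auto)
  then have "integrable (distr \<mu> borel T) (\<lambda>x. ln (f x))"
    by (subst integrable_distr_eq) auto
  moreover have "(\<integral>x. ln (f x) \<partial>distr \<mu> borel T) = (\<integral>x. ln (D x) + ?h x \<partial>\<mu>)"
    by (subst integral_distr) (auto intro!: integral_cong_AE AE)
  moreover have "(\<integral>x. ln (D x) + ?h x \<partial>\<mu>) = (\<integral>x. ln (D x) \<partial>\<mu>) + (\<integral>x. ?h x \<partial>\<mu>)"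
    by (rule Bochner_Integration.integral_add) (use D(4) int in auto)
  ultimately show ?thesis
    using relative_entropy_density[of std_gaussian f, OF sigma_finite_std_gaussian _ f, unfolded \<nu>] D(5)
    by (simp add: gaussian_entropy_def)
qed

section \<open>First variation of the entropy\<close>

lemma integrable_bounded_continuous:
  fixes f :: "'a::euclidean_space \<Rightarrow> 'b::euclidean_space"
  assumes "prob_space \<mu>" "sets \<mu> = sets borel" "continuous_on UNIV f" "bounded (range f)"
  shows "integrable \<mu> f"
proof -
  interpret prob_space \<mu> by fact
  obtain B where "\<And>x. norm (f x) \<le> B" using assms(4) by (auto simp: bounded_iff)
  moreover have "f \<in> borel_measurable \<mu>"
    using borel_measurable_continuous_onI[OF assms(3)] assms(2) by (simp cong: measurable_cong_sets)
  ultimately show ?thesis by (intro integrable_const_bound) auto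
qed

lemma integrable_test_function:
  fixes f :: "'a::euclidean_space \<Rightarrow> 'b::euclidean_space"
  assumes "prob_space \<mu>" "sets \<mu> = sets borel" "f \<in> test_functions U"
  shows "integrable \<mu> f"
  using assms by (intro integrable_bounded_continuous test_functions_continuous test_functions_bounded)

lemma test_function_times_coordinate:
  "\<phi> \<in> test_functions UNIV \<Longrightarrow> (\<lambda>x. (x \<bullet> e) * \<phi> x) \<in> test_functions UNIV"
  by (rule test_functions_mult_left) (auto intro!: C_k_bounded_linear bounded_linear_inner_left)

text \<open>Taking s = t and s = - t for a small t > 0 bounds the distance of \<open>A\<close> and
  \<open>J\<close> by \<epsilon> c + t K, which is arbitrarily small.\<close>

lemma first_order_eq:
  fixes A J K c :: real
  assumes "0 < \<delta>0" "0 \<le> c" "0 \<le> K"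
    and "\<And>\<epsilon>. 0 < \<epsilon> \<Longrightarrow> \<exists>\<delta>>0. \<forall>s. \<bar>s\<bar> < \<delta>0 \<longrightarrow> \<bar>s\<bar> * c < \<delta> \<longrightarrow> s * A - \<epsilon> * (\<bar>s\<bar> * c) \<le> s * J + s\<^sup>2 * K"
  shows "A = J"
proof -
  have "\<bar>A - J\<bar> \<le> 0 + \<epsilon> * (c + 1)" if "0 < \<epsilon>" for \<epsilon>
  proof -
    obtain \<delta> where \<delta>: "\<delta> > 0" "\<And>s. \<bar>s\<bar> < \<delta>0 \<Longrightarrow> \<bar>s\<bar> * c < \<delta> \<Longrightarrow> s * A - \<epsilon> * (\<bar>s\<bar> * c) \<le> s * J + s\<^sup>2 * K"
      using assms(4)[OF \<open>0 < \<epsilon>\<close>] by blast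
    \<comment> \<open>One entry for each demand: \<open>t < \<delta>0\<close>,
      \<open>t * c < \<delta>\<close> and \<open>t * K \<le> \<epsilon>\<close>. The added ones
      avoid dividing by zero when \<open>c\<close> or \<open>K\<close> vanishes.\<close>
    define t where "t = min (\<delta>0 / 2) (min (\<delta> / (c + 1) / 2) (\<epsilon> / (K + 1)))"
    have t: "0 < t" using \<delta>(1) assms \<open>0 < \<epsilon>\<close> by (simp add: t_def)
    have t1: "t < \<delta>0" using assms by (simp add: t_def)
    have "t \<le> \<delta> / (c + 1) / 2" by (simp add: t_def)
    then have "t * (c + 1) \<le> \<delta> / 2" using assms by (simp add: field_simps)
    moreover have "t * c \<le> t * (c + 1)" using t by simp
    ultimately have t2: "t * c < \<delta>" using \<delta>(1) by linarith
    have "t \<le> \<epsilon> / (K + 1)" by (simp add: t_def)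
    then have "t * (K + 1) \<le> \<epsilon>" using assms by (simp add: field_simps)
    then have t3: "t * K \<le> \<epsilon>" using t by (simp add: algebra_simps)
    have "t * (A - J) \<le> t * (\<epsilon> * c + t * K)" "t * (J - A) \<le> t * (\<epsilon> * c + t * K)"
      using \<delta>(2)[of t] \<delta>(2)[of "- t"] t t1 t2 by (simp_all add: algebra_simps power2_eq_square)
    then have "A - J \<le> \<epsilon> * c + t * K" "J - A \<le> \<epsilon> * c + t * K"
      using t by simp_all
    then show ?thesis using t3 by (simp add: algebra_simps abs_le_iff)
  qed
  moreover have "\<bar>A - J\<bar> \<le> 0" if *: "\<And>\<epsilon>. 0 < \<epsilon> \<Longrightarrow> \<bar>A - J\<bar> \<le> 0 + \<epsilon> * (c + 1)"
  proof (rule field_le_epsilon)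
    fix \<epsilon> :: real assume "0 < \<epsilon>"
    then show "\<bar>A - J\<bar> \<le> 0 + \<epsilon>" using *[of "\<epsilon> / (c + 1)"] assms by simp
  qed
  ultimately show ?thesis by simp
qed

text \<open>Half the difference of squared norms is s (x \<bullet> e) \<phi> plus s^2 \<phi>^2 |e|^2
  / 2, and the logarithm of the Jacobian is s d up to 2 (s d)^2, since |ln (1 + y) - y| \<le> 2 y^2
  for |y| \<le> 1/2. These two remainders make up the constant of s^2. The bound 1/2 also keeps the
  Jacobian positive, hence the shear injective.\<close>

lemma gaussian_entropy_shear_le:
  fixes \<mu> :: "(real^'n) measure" and \<phi> :: "real^'n \<Rightarrow> real" and e :: "real^'n"
  defines "d \<equiv> (\<lambda>x. frechet_derivative \<phi> (at x) e)"
  assumes \<mu>: "prob_space \<mu>" "sets \<mu> = sets borel" "gaussian_entropy \<mu> < \<infinity>"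
    and \<phi>: "\<phi> \<in> test_functions UNIV" and B: "\<And>x. \<bar>\<phi> x\<bar> \<le> B" "\<And>x. \<bar>s * d x\<bar> \<le> 1/2" "\<And>x. \<bar>d x\<bar> \<le> C"
  shows "gaussian_entropy (distr \<mu> borel (\<lambda>x. x + (s * \<phi> x) *\<^sub>R e)) \<le>
    gaussian_entropy \<mu> + ereal (s * (\<integral>x. (x \<bullet> e) * \<phi> x - d x \<partial>\<mu>) + s\<^sup>2 * (B\<^sup>2 * (norm e)\<^sup>2 / 2 + 2 * C\<^sup>2))"
proof -
  interpret prob_space \<mu> by fact
  note [measurable_cong] = \<mu>(2)
  let ?T = "\<lambda>x. x + (s * \<phi> x) *\<^sub>R e" and ?K = "B\<^sup>2 * (norm e)\<^sup>2 / 2 + 2 * C\<^sup>2"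
  let ?h = "\<lambda>x. ((norm (?T x))\<^sup>2 - (norm x)\<^sup>2) / 2 - ln (1 + s * d x)"
  have d: "d \<in> test_functions UNIV"
    unfolding d_def by (rule test_functions_frechet_derivative[OF \<phi>])
  have cont: "continuous_on UNIV \<phi>" "continuous_on UNIV d"
    by (rule test_functions_continuous \<phi> d)+
  have [measurable]: "\<phi> \<in> borel_measurable borel" "d \<in> borel_measurable borel"
    using cont by (auto intro: borel_measurable_continuous_onI)
  have deriv: "((\<lambda>r. s * \<phi> (x + r *\<^sub>R e)) has_real_derivative s * d x) (at 0)" for x
  proof -
    have "bounded_linear (\<lambda>r. r *\<^sub>R e)" by (rule bounded_linear_scaleR_left)
    from frechet_derivative_affine[OF test_functions_differentiable[OF \<phi>] this, of x 0]
    have "((\<lambda>r. \<phi> (x + r *\<^sub>R e)) has_derivative (\<lambda>r. frechet_derivative \<phi> (at x) (r *\<^sub>R e))) (at 0)"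
      by simp
    moreover have "frechet_derivative \<phi> (at x) (r *\<^sub>R e) = d x * r" for r
      unfolding d_def
      using linear_cmul[OF linear_frechet_derivative[OF test_functions_differentiable[OF \<phi>]]]
      by (simp add: mult.commute)
    ultimately have "((\<lambda>r. \<phi> (x + r *\<^sub>R e)) has_real_derivative d x) (at 0)"
      by (simp add: has_field_derivative_def)
    then show ?thesis by (rule DERIV_cmult)
  qed
  have pos: "0 < 1 + s * d x" for x using B(2)[of x] by (simp add: abs_le_iff)
  have contT: "continuous_on UNIV ?T" by (intro continuous_intros cont)
  obtain S where S: "S \<in> borel_measurable borel" "\<And>x. S (?T x) = x"
    using continuous_inj_borel_left_inverse[OF contT inj_shear[of "\<lambda>x. s * \<phi> x" e "\<lambda>x. s * d x", OF deriv pos]]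
    by blast
  have cov: "distr (density lborel (\<lambda>x. ennreal (1 + s * d x))) borel ?T = lborel"
    by (rule distr_shear_lborel[OF _ _ deriv pos, where C = "\<bar>s\<bar> * B"])
      (use B(1) cont in \<open>auto intro!: continuous_intros mult_left_mono simp: abs_mult\<close>)
  have bound: "\<bar>?h x - s * ((x \<bullet> e) * \<phi> x - d x)\<bar> \<le> s\<^sup>2 * ?K" for x
  proof -
    have "?h x - s * ((x \<bullet> e) * \<phi> x - d x) = s\<^sup>2 * ((\<phi> x)\<^sup>2 * (norm e)\<^sup>2 / 2) - (ln (1 + s * d x) - s * d x)"
      unfolding power2_norm_eq_inner
      by (simp add: inner_add inner_commute power2_eq_square algebra_simps)
    moreover have "\<bar>ln (1 + s * d x) - s * d x\<bar> \<le> 2 * (s * d x)\<^sup>2"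
      by (rule abs_ln_one_plus_x_minus_x_bound) (use B(2) in simp)
    moreover have "(s * d x)\<^sup>2 \<le> s\<^sup>2 * C\<^sup>2" "(\<phi> x)\<^sup>2 \<le> B\<^sup>2"
      unfolding power_mult_distrib using B(1,3)[of x]
      by (auto intro!: mult_left_mono abs_le_square_iff[THEN iffD1] intro: order_trans)
    moreover from this(2) have "s\<^sup>2 * ((\<phi> x)\<^sup>2 * (norm e)\<^sup>2 / 2) \<le> s\<^sup>2 * (B\<^sup>2 * (norm e)\<^sup>2 / 2)"
      by (intro mult_left_mono divide_right_mono mult_right_mono) auto
    moreover have "0 \<le> s\<^sup>2 * ((\<phi> x)\<^sup>2 * (norm e)\<^sup>2 / 2)" by simp
    ultimately show ?thesis unfolding distrib_left abs_le_iff by linarith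
  qed
  have intI: "integrable \<mu> (\<lambda>x. (x \<bullet> e) * \<phi> x - d x)"
    by (intro Bochner_Integration.integrable_diff integrable_test_function[OF \<mu>(1,2), where U = UNIV]
        test_function_times_coordinate \<phi> d)
  have "integrable \<mu> (\<lambda>x. ?h x - s * ((x \<bullet> e) * \<phi> x - d x))"
    by (rule integrable_const_bound[where B = "s\<^sup>2 * ?K"]) (use bound in auto)
  from Bochner_Integration.integrable_add[OF this integrable_mult_right[OF intI, of s]]
  have inth: "integrable \<mu> ?h" by simp
  have "(\<integral>x. ?h x \<partial>\<mu>) \<le> (\<integral>x. s * ((x \<bullet> e) * \<phi> x - d x) + s\<^sup>2 * ?K \<partial>\<mu>)"
  proof (rule integral_mono)
    show "?h x \<le> s * ((x \<bullet> e) * \<phi> x - d x) + s\<^sup>2 * ?K" for x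
      using bound[of x] by linarith
  qed (use intI inth in auto)
  also have "\<dots> = s * (\<integral>x. (x \<bullet> e) * \<phi> x - d x \<partial>\<mu>) + s\<^sup>2 * ?K"
    using intI by (subst Bochner_Integration.integral_add) (auto simp: prob_space)
  finally have "ereal (\<integral>x. ?h x \<partial>\<mu>) \<le> ereal (s * (\<integral>x. (x \<bullet> e) * \<phi> x - d x \<partial>\<mu>) + s\<^sup>2 * ?K)"
    by simp
  moreover have "gaussian_entropy (distr \<mu> borel ?T) = gaussian_entropy \<mu> + ereal (\<integral>x. ?h x \<partial>\<mu>)"
    by (rule gaussian_entropy_distr[OF \<mu> _ S(1) _ S(2) pos cov inth]) measurable
  ultimately show ?thesis by (simp add: add_left_mono)
qed


lemma P2D:
  assumes "\<mu> \<in> P2"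
  shows "prob_space \<mu>" "sets \<mu> = sets borel" "integrable \<mu> (\<lambda>x. (norm x)\<^sup>2)"
  using assms by (auto simp: P2_def)

lemma L2_add_test_function:
  assumes "\<mu> \<in> P2" "g \<in> test_functions UNIV"
  shows "(\<lambda>x. x + g x) \<in> L2 \<mu>"
proof -
  note \<mu> = P2D[OF assms(1)]
  note [measurable_cong] = \<mu>(2)
  interpret prob_space \<mu> by (rule \<mu>)
  have [measurable]: "g \<in> borel_measurable borel"
    by (rule borel_measurable_continuous_onI[OF test_functions_continuous[OF assms(2)]])
  obtain B where B: "\<And>x. norm (g x) \<le> B"
    using test_functions_bounded[OF assms(2)] by (auto simp: bounded_iff)
  have "integrable \<mu> (\<lambda>x. (norm (x + g x))\<^sup>2)"
  proof (rule Bochner_Integration.integrable_bound)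
    show "integrable \<mu> (\<lambda>x. 2 * (norm x)\<^sup>2 + 2 * B\<^sup>2)" using \<mu>(3) by simp
    have "(norm (x + g x))\<^sup>2 \<le> 2 * (norm x)\<^sup>2 + 2 * B\<^sup>2" for x
    proof -
      have "norm (x + g x) \<le> norm x + B"
        using norm_triangle_ineq[of x "g x"] B[of x] by linarith
      then have "(norm (x + g x))\<^sup>2 \<le> (norm x + B)\<^sup>2" by (rule power_mono) simp
      also have "\<dots> \<le> 2 * (norm x)\<^sup>2 + 2 * B\<^sup>2"
        using sum_squares_bound[of "norm x" B] by (simp add: power2_sum)
      finally show ?thesis .
    qed
    then show "AE x in \<mu>. norm ((norm (x + g x))\<^sup>2) \<le> norm (2 * (norm x)\<^sup>2 + 2 * B\<^sup>2)"
      by simp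
  qed simp
  then show ?thesis by (auto simp: L2_def)
qed

text \<open>Along the shears the subgradient inequality bounds the entropy from below and the shear
  estimate from above. Both bounds are linear in s up to o(s) and hold for either sign of s, so
  their slopes agree.\<close>

lemma subdifferential_first_variation:
  fixes \<mu> :: "(real^'n) measure" and \<phi> :: "real^'n \<Rightarrow> real" and e :: "real^'n"
  assumes "\<xi> \<in> subdifferential gaussian_entropy \<mu>" and \<phi>: "\<phi> \<in> test_functions UNIV"
  shows "(\<integral>x. (\<phi> x *\<^sub>R e) \<bullet> \<xi> x \<partial>\<mu>) = (\<integral>x. (x \<bullet> e) * \<phi> x - frechet_derivative \<phi> (at x) e \<partial>\<mu>)"
    (is "?A = ?J")
proof -
  have P2: "\<mu> \<in> P2" and fin: "gaussian_entropy \<mu> < \<infinity>"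
    and sub: "\<And>\<epsilon>. \<epsilon> > 0 \<Longrightarrow> \<exists>\<delta>>0. \<forall>T\<in>L2 \<mu>. L2_norm \<mu> (\<lambda>x. T x - x) < \<delta> \<longrightarrow>
        gaussian_entropy \<mu> + ereal ((\<integral>x. \<xi> x \<bullet> (T x - x) \<partial>\<mu>) - \<epsilon> * L2_norm \<mu> (\<lambda>x. T x - x))
          \<le> gaussian_entropy (distr \<mu> borel T)"
    using assms(1) by (auto simp: subdifferential_def)
  note \<mu> = P2D[OF P2]
  \<comment> \<open>A real value is needed to cancel the entropy from both sides of an extended-real
    inequality.\<close>
  obtain a where a: "gaussian_entropy \<mu> = ereal a"
    using fin by (auto simp: gaussian_entropy_def relative_entropy_def split: if_splits)
  obtain B where B: "\<And>x. \<bar>\<phi> x\<bar> \<le> B"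
    using test_functions_bounded[OF \<phi>] by (auto simp: bounded_iff)
  obtain C where C: "\<And>x. \<bar>frechet_derivative \<phi> (at x) e\<bar> \<le> C"
    using test_functions_bounded[OF test_functions_frechet_derivative[OF \<phi>, of e]] by (auto simp: bounded_iff)
  have "0 \<le> C" using C[of 0] by linarith
  let ?K = "B\<^sup>2 * (norm e)\<^sup>2 / 2 + 2 * C\<^sup>2" and ?c = "L2_norm \<mu> (\<lambda>x. \<phi> x *\<^sub>R e)"
  show ?thesis
  proof (rule first_order_eq)
    \<comment> \<open>For s below this threshold the derivative of s \<phi> along \<open>e\<close>
      is at most 1/2 in absolute value; C + 1 replaces C because C may be 0.\<close>
    show "0 < 1 / (2 * (C + 1))" "0 \<le> ?c" "0 \<le> ?K" using \<open>0 \<le> C\<close> by (simp_all add: L2_norm_def)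
    fix \<epsilon> :: real assume "0 < \<epsilon>"
    then obtain \<delta> where \<delta>: "\<delta> > 0" "\<And>T. T \<in> L2 \<mu> \<Longrightarrow> L2_norm \<mu> (\<lambda>x. T x - x) < \<delta> \<Longrightarrow>
        gaussian_entropy \<mu> + ereal ((\<integral>x. \<xi> x \<bullet> (T x - x) \<partial>\<mu>) - \<epsilon> * L2_norm \<mu> (\<lambda>x. T x - x))
          \<le> gaussian_entropy (distr \<mu> borel T)"
      using sub by blast
    show "\<exists>\<delta>>0. \<forall>s. \<bar>s\<bar> < 1 / (2 * (C + 1)) \<longrightarrow> \<bar>s\<bar> * ?c < \<delta> \<longrightarrow>
        s * ?A - \<epsilon> * (\<bar>s\<bar> * ?c) \<le> s * ?J + s\<^sup>2 * ?K"
    proof (intro exI conjI allI impI)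
      show "0 < \<delta>" by fact
      fix s assume s: "\<bar>s\<bar> < 1 / (2 * (C + 1))" "\<bar>s\<bar> * ?c < \<delta>"
      let ?T = "\<lambda>x. x + (s * \<phi> x) *\<^sub>R e"
      have norm: "L2_norm \<mu> (\<lambda>x. ?T x - x) = \<bar>s\<bar> * ?c"
        by (simp add: L2_norm_def power_mult_distrib mult.assoc real_sqrt_mult)
      have "(\<integral>x. \<xi> x \<bullet> (?T x - x) \<partial>\<mu>) = (\<integral>x. s * ((\<phi> x *\<^sub>R e) \<bullet> \<xi> x) \<partial>\<mu>)"
        by (simp add: inner_commute mult.assoc)
      then have inner: "(\<integral>x. \<xi> x \<bullet> (?T x - x) \<partial>\<mu>) = s * ?A" by simp
      have "(\<lambda>x. \<phi> x *\<^sub>R (s *\<^sub>R e)) \<in> test_functions UNIV"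
        by (rule test_functions_scaleR_vector[OF \<phi>])
      from L2_add_test_function[OF P2 this] have "?T \<in> L2 \<mu>" by (simp add: mult.commute)
      from \<delta>(2)[OF this] s(2) norm inner
      have "gaussian_entropy \<mu> + ereal (s * ?A - \<epsilon> * (\<bar>s\<bar> * ?c)) \<le> gaussian_entropy (distr \<mu> borel ?T)"
        by simp
      also have "\<bar>s * frechet_derivative \<phi> (at x) e\<bar> \<le> 1 / 2" for x
      proof -
        have "\<bar>s\<bar> * \<bar>frechet_derivative \<phi> (at x) e\<bar> \<le> 1 / (2 * (C + 1)) * (C + 1)"
          using s(1) C[of x] \<open>0 \<le> C\<close> by (intro mult_mono) auto
        also have "\<dots> = 1 / 2" using \<open>0 \<le> C\<close> by (simp add: field_simps)
        finally show ?thesis by (simp add: abs_mult)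
      qed
      then have "gaussian_entropy (distr \<mu> borel ?T) \<le> gaussian_entropy \<mu> + ereal (s * ?J + s\<^sup>2 * ?K)"
        by (intro gaussian_entropy_shear_le \<mu> fin \<phi> B C)
      finally show "s * ?A - \<epsilon> * (\<bar>s\<bar> * ?c) \<le> s * ?J + s\<^sup>2 * ?K" by (simp add: a)
    qed
  qed
qed

text \<open>The compact support of \<phi> tames the factor x \<bullet> e: the right-hand integrand
  is bounded and continuous, so weak convergence suffices there. The left-hand side converges by the
  vector-field convergence built into the limiting subdifferential.\<close>

lemma limiting_subdifferential_first_variation:
  fixes \<mu> :: "(real^'n) measure" and \<phi> :: "real^'n \<Rightarrow> real" and e :: "real^'n"
  assumes "\<xi> \<in> limiting_subdifferential gaussian_entropy \<mu>" and \<phi>: "\<phi> \<in> test_functions UNIV"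
  shows "(\<integral>x. (\<phi> x *\<^sub>R e) \<bullet> \<xi> x \<partial>\<mu>) = (\<integral>x. (x \<bullet> e) * \<phi> x - frechet_derivative \<phi> (at x) e \<partial>\<mu>)"
proof -
  let ?f = "\<lambda>x. (x \<bullet> e) * \<phi> x - frechet_derivative \<phi> (at x) e"
  obtain M \<Xi> where M: "weakly_converges M \<mu>" "\<And>k. \<Xi> k \<in> subdifferential gaussian_entropy (M k)"
    "\<And>g. g \<in> test_functions UNIV \<Longrightarrow> (\<lambda>k. \<integral>x. g x \<bullet> \<Xi> k x \<partial>M k) \<longlonglongrightarrow> (\<integral>x. g x \<bullet> \<xi> x \<partial>\<mu>)"
    using assms(1) unfolding limiting_subdifferential_def by blast
  note t = test_function_times_coordinate[OF \<phi>, of e] test_functions_frechet_derivative[OF \<phi>, of e]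
  have "continuous_on UNIV ?f"
    by (intro continuous_on_diff test_functions_continuous[OF t(1)] test_functions_continuous[OF t(2)])
  moreover have "bounded (range ?f)"
    by (rule bounded_minus_comp[OF test_functions_bounded[OF t(1)] test_functions_bounded[OF t(2)]])
  ultimately have "(\<lambda>k. \<integral>x. ?f x \<partial>M k) \<longlonglongrightarrow> (\<integral>x. ?f x \<partial>\<mu>)"
    using M(1) by (auto simp: weakly_converges_def)
  moreover have "(\<lambda>k. \<integral>x. (\<phi> x *\<^sub>R e) \<bullet> \<Xi> k x \<partial>M k) \<longlonglongrightarrow> (\<integral>x. (\<phi> x *\<^sub>R e) \<bullet> \<xi> x \<partial>\<mu>)"
    by (rule M(3)[OF test_functions_scaleR_vector[OF \<phi>]])
  ultimately show ?thesis
    unfolding subdifferential_first_variation[OF M(2) \<phi>] using LIMSEQ_unique by blast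
qed

section \<open>Moments of limiting subgradients\<close>

lemma norm_outer: "norm (outer x y) = norm x * norm y"
proof -
  have "outer x y $ i = x $ i *\<^sub>R y" for i by (simp add: outer_def vec_eq_iff)
  moreover have "norm (outer x y) = L2_set (\<lambda>i. norm (outer x y $ i)) UNIV"
    by (rule norm_vec_def)
  ultimately have "norm (outer x y) = L2_set (\<lambda>i. norm (x $ i) * norm y) UNIV"
    by simp
  then show ?thesis by (simp only: norm_vec_def[of x] L2_set_left_distrib[OF norm_ge_zero])
qed

lemma bounded_bilinear_outer: "bounded_bilinear (outer :: real^'n \<Rightarrow> real^'n \<Rightarrow> real^'n^'n)"
  by (rule bounded_bilinear.intro)
    (auto simp: outer_def vec_eq_iff algebra_simps intro!: exI[of _ 1] norm_outer[unfolded outer_def, THEN eq_refl])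

lemma borel_measurable_outer [measurable (raw)]:
  assumes "f \<in> borel_measurable M" "g \<in> borel_measurable M"
  shows "(\<lambda>x. outer (f x) (g x)) \<in> borel_measurable M"
  using assms
  by (rule borel_measurable_continuous_Pair)
    (intro bounded_bilinear.continuous_on[OF bounded_bilinear_outer] continuous_intros)

lemma integrable_norm_mult_norm:
  fixes f :: "'a \<Rightarrow> 'b::euclidean_space" and g :: "'a \<Rightarrow> 'c::euclidean_space"
  assumes [measurable]: "f \<in> borel_measurable M" "g \<in> borel_measurable M"
    and "integrable M (\<lambda>x. (norm (f x))\<^sup>2)" "integrable M (\<lambda>x. (norm (g x))\<^sup>2)"
  shows "integrable M (\<lambda>x. norm (f x) * norm (g x))"
proof (rule Bochner_Integration.integrable_bound)
  show "integrable M (\<lambda>x. (norm (f x))\<^sup>2 + (norm (g x))\<^sup>2)"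
    using assms(3,4) by simp
  have "a * b \<le> a\<^sup>2 + b\<^sup>2" if "0 \<le> a" "0 \<le> b" for a b :: real
    using sum_squares_bound[of a b] mult_nonneg_nonneg[OF that] by linarith
  then show "AE x in M. norm (norm (f x) * norm (g x)) \<le> norm ((norm (f x))\<^sup>2 + (norm (g x))\<^sup>2)"
    by (simp add: abs_mult)
qed measurable

lemma integrable_outer:
  fixes f g :: "real^'n \<Rightarrow> real^'n"
  assumes "f \<in> borel_measurable M" "g \<in> borel_measurable M"
    and "integrable M (\<lambda>x. (norm (f x))\<^sup>2)" "integrable M (\<lambda>x. (norm (g x))\<^sup>2)"
  shows "integrable M (\<lambda>x. outer (f x) (g x))"
    and "integrable M (\<lambda>x. f x $ i * g x $ j)"
    and "(\<integral>x. outer (f x) (g x) \<partial>M) $ i $ j = (\<integral>x. f x $ i * g x $ j \<partial>M)"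
proof -
  show *: "integrable M (\<lambda>x. outer (f x) (g x))"
    by (rule Bochner_Integration.integrable_bound[OF integrable_norm_mult_norm[OF assms]])
      (use assms(1,2) in \<open>auto simp: norm_outer\<close>)
  have bl: "bounded_linear (\<lambda>A::real^'n^'n. A $ i $ j)"
    by (rule bounded_linear_compose[OF bounded_linear_vec_nth bounded_linear_vec_nth])
  show "integrable M (\<lambda>x. f x $ i * g x $ j)"
    using integrable_bounded_linear[OF bl *] by (simp add: outer_def)
  show "(\<integral>x. outer (f x) (g x) \<partial>M) $ i $ j = (\<integral>x. f x $ i * g x $ j \<partial>M)"
    using integral_bounded_linear[OF bl *] by (simp add: outer_def)
qed

lemma L2D:
  assumes "\<mu> \<in> P2" "f \<in> L2 \<mu>"
  shows "f \<in> borel_measurable \<mu>" "integrable \<mu> (\<lambda>x. (norm (f x))\<^sup>2)"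
  using assms P2D[OF assms(1)] by (auto simp: L2_def cong: measurable_cong_sets)

lemma id_in_L2: "\<mu> \<in> P2 \<Longrightarrow> (\<lambda>x. x) \<in> L2 \<mu>"
  by (auto simp: L2_def P2_def)

lemma outer_moments:
  assumes "\<mu> \<in> P2" "f \<in> L2 \<mu>" "g \<in> L2 \<mu>"
  shows "integrable \<mu> (\<lambda>x. f x $ i * g x $ j)"
    and "(\<integral>x. outer (f x) (g x) \<partial>\<mu>) $ i $ j = (\<integral>x. f x $ i * g x $ j \<partial>\<mu>)"
  using integrable_outer[of f \<mu> g] L2D[OF assms(1)] assms(2,3) by blast+

text \<open>The first-variation identity for the unbounded function x \<bullet> w, reached through
  the dilated cutoffs \<open>\<phi> n\<close> and dominated convergence. The integrands are
  dominated by multiples of |x| |\<xi>| and |x|^2 plus constants, and \<eta> 0 = 1 makes the cutoffs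
  tend to 1.\<close>

lemma limiting_subdifferential_moment:
  fixes \<mu> :: "(real^'n) measure"
  assumes \<mu>: "\<mu> \<in> P2" and \<xi>: "\<xi> \<in> limiting_subdifferential gaussian_entropy \<mu>"
  shows "(\<integral>x. (x \<bullet> w) * (e \<bullet> \<xi> x) \<partial>\<mu>) = (\<integral>x. (x \<bullet> e) * (x \<bullet> w) \<partial>\<mu>) - e \<bullet> w"
proof -
  note \<mu>' = P2D[OF \<mu>]
  note [measurable_cong] = \<mu>'(2)
  interpret prob_space \<mu> by (rule \<mu>')
  have \<xi>L: "\<xi> \<in> L2 \<mu>" using \<xi> by (auto simp: limiting_subdifferential_def)
  note [measurable] = L2D(1)[OF \<mu> \<xi>L]
  obtain \<eta> :: "real^'n \<Rightarrow> real" where \<eta>: "\<eta> \<in> test_functions UNIV" "\<eta> 0 = 1"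
    by (rule bump_exists)
  define d\<eta> where "d\<eta> x = frechet_derivative \<eta> (at x) e" for x
  \<comment> \<open>Differentiating the cutoff gives (x \<bullet> w) times
    \<open>a n * d\<eta> (a n *\<^sub>R x)\<close>, which is \<psi> at the scaled point. The small
    factor absorbs the growth of x \<bullet> w: the term is bounded by \<open>C\<close> uniformly in
    n and tends to \<psi> 0 = 0.\<close>
  define \<psi> where "\<psi> y = (y \<bullet> w) * d\<eta> y" for y
  have d\<eta>: "d\<eta> \<in> test_functions UNIV"
    unfolding d\<eta>_def by (rule test_functions_frechet_derivative[OF \<eta>(1)])
  then have \<psi>: "\<psi> \<in> test_functions UNIV"
    unfolding \<psi>_def by (rule test_function_times_coordinate)
  obtain B where B: "\<And>x. \<bar>\<eta> x\<bar> \<le> B"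
    using test_functions_bounded[OF \<eta>(1)] by (auto simp: bounded_iff)
  have "0 \<le> B" using B[of 0] by linarith
  obtain C where C: "\<And>x. \<bar>\<psi> x\<bar> \<le> C"
    using test_functions_bounded[OF \<psi>] by (auto simp: bounded_iff)
  have cont: "continuous_on UNIV \<eta>" "continuous_on UNIV \<psi>" "continuous_on UNIV d\<eta>"
    by (rule test_functions_continuous \<eta> \<psi> d\<eta>)+
  note [measurable] = cont[THEN borel_measurable_continuous_onI]
  define a where "a n = inverse (real (Suc n))" for n
  have a: "a \<longlonglongrightarrow> 0" unfolding a_def by (rule LIMSEQ_inverse_real_of_nat)
  have a0: "a n \<noteq> 0" for n by (simp add: a_def)
  have lim: "(\<lambda>n. f (a n *\<^sub>R x)) \<longlonglongrightarrow> f 0" if "continuous_on UNIV f" for f :: "real^'n \<Rightarrow> real" and x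
  proof -
    have "(\<lambda>n. a n *\<^sub>R x) \<longlonglongrightarrow> 0" using tendsto_scaleR[OF a tendsto_const, of x] by simp
    then show ?thesis using that continuous_on_tendsto_compose[of UNIV f] by simp
  qed
  have bl: "bounded_linear (\<lambda>x. a n *\<^sub>R x :: real^'n)" for n by (rule bounded_linear_scaleR_right)
  define \<phi> where "\<phi> n x = (x \<bullet> w) * \<eta> (a n *\<^sub>R x)" for n x
  have eta_n: "(\<lambda>x. \<eta> (a n *\<^sub>R x)) \<in> test_functions UNIV" for n
  proof (rule test_functionsI)
    show "C_k k (\<lambda>x. \<eta> (a n *\<^sub>R x))" for k
      using C_k_affine[OF bl, of k \<eta> 0 n] test_functions_C_k[OF \<eta>(1)] by simp
    show "bounded ((\<lambda>y. inverse (a n) *\<^sub>R y) ` {x. \<eta> x \<noteq> 0})"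
      by (rule bounded_scaling[OF test_functions_support[OF \<eta>(1)]])
    show "x \<in> (\<lambda>y. inverse (a n) *\<^sub>R y) ` {x. \<eta> x \<noteq> 0}" if "\<eta> (a n *\<^sub>R x) \<noteq> 0" for x
      by (rule image_eqI[of _ _ "a n *\<^sub>R x"]) (use that a0 in auto)
  qed
  have \<phi>: "\<phi> n \<in> test_functions UNIV" for n
    unfolding \<phi>_def by (rule test_function_times_coordinate[OF eta_n])
  have d\<phi>: "frechet_derivative (\<phi> n) (at x) e = (e \<bullet> w) * \<eta> (a n *\<^sub>R x) + \<psi> (a n *\<^sub>R x)" for n x
  proof -
    have "((\<lambda>x. \<eta> (a n *\<^sub>R x)) has_derivative (\<lambda>h. frechet_derivative \<eta> (at (a n *\<^sub>R x)) (a n *\<^sub>R h))) (at x)"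
      using frechet_derivative_affine[OF test_functions_differentiable[OF \<eta>(1)] bl[of n], of 0] by simp
    moreover have "((\<lambda>x. x \<bullet> w) has_derivative (\<lambda>h. h \<bullet> w)) (at x)"
      by (intro bounded_linear_imp_has_derivative bounded_linear_inner_left)
    ultimately have "(\<phi> n has_derivative (\<lambda>h. (x \<bullet> w) * frechet_derivative \<eta> (at (a n *\<^sub>R x)) (a n *\<^sub>R h)
        + (h \<bullet> w) * \<eta> (a n *\<^sub>R x))) (at x)"
      unfolding \<phi>_def by (rule has_derivative_mult[rotated])
    from frechet_derivative_at[OF this, symmetric]
    have "frechet_derivative (\<phi> n) (at x) e =
        (x \<bullet> w) * frechet_derivative \<eta> (at (a n *\<^sub>R x)) (a n *\<^sub>R e) + (e \<bullet> w) * \<eta> (a n *\<^sub>R x)" by simp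
    also have "frechet_derivative \<eta> (at (a n *\<^sub>R x)) (a n *\<^sub>R e) = a n * d\<eta> (a n *\<^sub>R x)"
      unfolding d\<eta>_def
      using linear_cmul[OF linear_frechet_derivative[OF test_functions_differentiable[OF \<eta>(1)]]] by simp
    finally show ?thesis by (simp add: \<psi>_def)
  qed
  have id: "(\<lambda>x. x) \<in> L2 \<mu>" by (rule id_in_L2[OF \<mu>])
  have ident_int: "integrable \<mu> (\<lambda>x. norm x * norm x)" "integrable \<mu> (\<lambda>x. norm x * norm (\<xi> x))"
    using integrable_norm_mult_norm[OF L2D(1)[OF \<mu> id] L2D(1)[OF \<mu> id] L2D(2)[OF \<mu> id] L2D(2)[OF \<mu> id]]
      integrable_norm_mult_norm[OF L2D(1)[OF \<mu> id] L2D(1)[OF \<mu> \<xi>L] L2D(2)[OF \<mu> id] L2D(2)[OF \<mu> \<xi>L]] by auto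
  have cs: "\<bar>(x \<bullet> u) * (y \<bullet> z) * \<eta> t\<bar> \<le> (norm u * norm y * B) * (norm x * norm z)" for x u y z t :: "real^'n"
  proof -
    have "\<bar>x \<bullet> u\<bar> * \<bar>y \<bullet> z\<bar> * \<bar>\<eta> t\<bar> \<le> (norm x * norm u) * (norm y * norm z) * B"
      by (intro mult_mono Cauchy_Schwarz_ineq2 B) auto
    then show ?thesis by (simp add: abs_mult ac_simps)
  qed
  have "(\<lambda>n. \<integral>x. (x \<bullet> w) * (e \<bullet> \<xi> x) * \<eta> (a n *\<^sub>R x) \<partial>\<mu>) \<longlonglongrightarrow> (\<integral>x. (x \<bullet> w) * (e \<bullet> \<xi> x) \<partial>\<mu>)"
  proof (rule integral_dominated_convergence)
    show "integrable \<mu> (\<lambda>x. (norm w * norm e * B) * (norm x * norm (\<xi> x)))" by (rule integrable_mult_right[OF ident_int(2)])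
    show "AE x in \<mu>. (\<lambda>n. (x \<bullet> w) * (e \<bullet> \<xi> x) * \<eta> (a n *\<^sub>R x)) \<longlonglongrightarrow> (x \<bullet> w) * (e \<bullet> \<xi> x)"
    proof (rule AE_I2)
      fix x
      show "(\<lambda>n. (x \<bullet> w) * (e \<bullet> \<xi> x) * \<eta> (a n *\<^sub>R x)) \<longlonglongrightarrow> (x \<bullet> w) * (e \<bullet> \<xi> x)"
        using tendsto_mult[OF tendsto_const lim[OF cont(1), of x], of "(x \<bullet> w) * (e \<bullet> \<xi> x)"] by (simp add: \<eta>(2))
    qed
    show "AE x in \<mu>. norm ((x \<bullet> w) * (e \<bullet> \<xi> x) * \<eta> (a n *\<^sub>R x)) \<le> (norm w * norm e * B) * (norm x * norm (\<xi> x))" for n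
      by (rule AE_I2) (simp only: real_norm_def cs)
  qed measurable
  moreover have "(\<lambda>n. \<integral>x. (x \<bullet> e) * (w \<bullet> x) * \<eta> (a n *\<^sub>R x) - ((e \<bullet> w) * \<eta> (a n *\<^sub>R x) + \<psi> (a n *\<^sub>R x)) \<partial>\<mu>)
      \<longlonglongrightarrow> (\<integral>x. (x \<bullet> e) * (w \<bullet> x) - e \<bullet> w \<partial>\<mu>)"
  proof (rule integral_dominated_convergence)
    show "integrable \<mu> (\<lambda>x. (norm e * norm w * B) * (norm x * norm x) + (\<bar>e \<bullet> w\<bar> * B + C))"
      by (intro Bochner_Integration.integrable_add integrable_mult_right ident_int(1) integrable_const)
    have "\<psi> 0 = 0" by (simp add: \<psi>_def)
    then have "(\<lambda>n. (x \<bullet> e) * (w \<bullet> x) * \<eta> (a n *\<^sub>R x) - ((e \<bullet> w) * \<eta> (a n *\<^sub>R x) + \<psi> (a n *\<^sub>R x)))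
       \<longlonglongrightarrow> (x \<bullet> e) * (w \<bullet> x) * 1 - ((e \<bullet> w) * 1 + 0)" for x
      using lim[OF cont(1), of x] lim[OF cont(2), of x] \<eta>(2) by (intro tendsto_intros) auto
    then show "AE x in \<mu>. (\<lambda>n. (x \<bullet> e) * (w \<bullet> x) * \<eta> (a n *\<^sub>R x) - ((e \<bullet> w) * \<eta> (a n *\<^sub>R x) + \<psi> (a n *\<^sub>R x)))
       \<longlonglongrightarrow> (x \<bullet> e) * (w \<bullet> x) - e \<bullet> w" by simp
    have "\<bar>(x \<bullet> e) * (w \<bullet> x) * \<eta> t - ((e \<bullet> w) * \<eta> t + \<psi> t)\<bar> \<le>
        (norm e * norm w * B) * (norm x * norm x) + (\<bar>e \<bullet> w\<bar> * B + C)" for x t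
    proof -
      have "\<bar>(e \<bullet> w) * \<eta> t\<bar> \<le> \<bar>e \<bullet> w\<bar> * B" using B by (auto simp: abs_mult intro: mult_left_mono)
      then show ?thesis using cs[of x e w x t] C[of t] by linarith
    qed
    then show "AE x in \<mu>. norm ((x \<bullet> e) * (w \<bullet> x) * \<eta> (a n *\<^sub>R x) - ((e \<bullet> w) * \<eta> (a n *\<^sub>R x) + \<psi> (a n *\<^sub>R x))) \<le>
        (norm e * norm w * B) * (norm x * norm x) + (\<bar>e \<bullet> w\<bar> * B + C)" for n by simp
  qed measurable
  moreover have "(\<integral>x. (x \<bullet> w) * (e \<bullet> \<xi> x) * \<eta> (a n *\<^sub>R x) \<partial>\<mu>) =
      (\<integral>x. (x \<bullet> e) * (w \<bullet> x) * \<eta> (a n *\<^sub>R x) - ((e \<bullet> w) * \<eta> (a n *\<^sub>R x) + \<psi> (a n *\<^sub>R x)) \<partial>\<mu>)" for n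
    using limiting_subdifferential_first_variation[OF \<xi> \<phi>, of n e]
    by (simp add: d\<phi> \<phi>_def mult.assoc mult.left_commute inner_commute[of w]) (simp add: ac_simps)
  ultimately have "(\<integral>x. (x \<bullet> w) * (e \<bullet> \<xi> x) \<partial>\<mu>) = (\<integral>x. (x \<bullet> e) * (w \<bullet> x) - e \<bullet> w \<partial>\<mu>)"
    using LIMSEQ_unique by simp
  also have "integrable \<mu> (\<lambda>x. (x \<bullet> e) * (w \<bullet> x))"
  proof (rule Bochner_Integration.integrable_bound)
    show "integrable \<mu> (\<lambda>x. (norm e * norm w) * (norm x * norm x))"
      by (rule integrable_mult_right[OF ident_int(1)])
    have "\<bar>x \<bullet> e\<bar> * \<bar>w \<bullet> x\<bar> \<le> (norm x * norm e) * (norm w * norm x)" for x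
      by (intro mult_mono Cauchy_Schwarz_ineq2) auto
    then show "AE x in \<mu>. norm ((x \<bullet> e) * (w \<bullet> x)) \<le> norm ((norm e * norm w) * (norm x * norm x))"
      by (simp add: abs_mult ac_simps)
  qed measurable
  then have "(\<integral>x. (x \<bullet> e) * (w \<bullet> x) - e \<bullet> w \<partial>\<mu>) = (\<integral>x. (x \<bullet> e) * (x \<bullet> w) \<partial>\<mu>) - e \<bullet> w"
    by (subst Bochner_Integration.integral_diff) (auto simp: prob_space inner_commute)
  finally show ?thesis .
qed

section \<open>Uniqueness of symmetric solutions of the Lyapunov equation\<close>

lemma matrix_mult_diff_distrib:
  fixes A B C :: "real^'n^'n"
  shows "A ** (B - C) = A ** B - A ** C" "(B - C) ** A = B ** A - C ** A"
  by (simp_all add: vec_eq_iff matrix_matrix_mult_def algebra_simps sum_subtractf)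

lemma matrix_mult_scaleR:
  fixes A B :: "real^'n^'n"
  shows "A ** (c *\<^sub>R B) = c *\<^sub>R (A ** B)" "(c *\<^sub>R A) ** B = c *\<^sub>R (A ** B)"
  by (simp_all add: vec_eq_iff matrix_matrix_mult_def sum_distrib_left algebra_simps)

lemma trace_congruence:
  fixes X S :: "real^'n^'n"
  assumes "transpose X = X"
  shows "trace (X ** S ** X) = (\<Sum>k\<in>UNIV. (X *v axis k 1) \<bullet> (S *v (X *v axis k 1)))"
proof -
  have "(X ** S ** X) $ k $ k = (X *v axis k 1) \<bullet> (S *v (X *v axis k 1))" for k
  proof -
    have "(X *v axis k 1) \<bullet> (S *v (X *v axis k 1)) = axis k 1 \<bullet> (X *v (S *v (X *v axis k 1)))"
      by (metis assms dot_lmul_matrix vector_transpose_matrix)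
    also have "\<dots> = ((X ** S) *v (X *v axis k 1)) $ k"
      by (simp add: matrix_vector_mul_assoc[symmetric] inner_axis')
    also have "\<dots> = (X ** S ** X) $ k $ k"
      by (simp add: matrix_vector_mult_basis column_def matrix_vector_mult_def[of "X ** S"]
          matrix_matrix_mult_def[of "X ** S"])
    finally show ?thesis ..
  qed
  then show ?thesis by (simp add: trace_def)
qed

text \<open>Multiplying the equation by X and taking the trace gives, by cyclicity, twice the trace
  of X S X. This trace is the sum of the quadratic form of S over the columns of X, so every column
  vanishes.\<close>

lemma Lyapunov_unique:
  fixes X S :: "real^'n^'n"
  assumes X: "transpose X = X" and S: "\<And>u. u \<noteq> 0 \<Longrightarrow> 0 < u \<bullet> (S *v u)" and eq: "S ** X + X ** S = 0"
  shows "X = 0"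
proof -
  have "0 = trace (X ** (S ** X + X ** S))" unfolding eq by (simp add: trace_def matrix_matrix_mult_def)
  also have "\<dots> = trace (X ** (S ** X)) + trace (X ** (X ** S))"
    by (simp only: matrix_add_ldistrib trace_add)
  also have "trace (X ** (X ** S)) = trace ((X ** S) ** X)" by (rule trace_mul_sym)
  finally have "trace (X ** S ** X) = 0" by (simp add: matrix_mul_assoc)
  then have "(\<Sum>k\<in>UNIV. (X *v axis k 1) \<bullet> (S *v (X *v axis k 1))) = 0"
    by (simp add: trace_congruence[OF X])
  moreover have "0 \<le> u \<bullet> (S *v u)" for u using S[of u] by (cases "u = 0") auto
  ultimately have "(X *v axis k 1) \<bullet> (S *v (X *v axis k 1)) = 0" for k
    by (subst (asm) sum_nonneg_eq_0_iff) auto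
  then have "X *v axis k 1 = 0" for k using S[of "X *v axis k 1"] by fastforce
  then show ?thesis
    by (simp add: vec_eq_iff matrix_vector_mult_basis column_def)
qed

text \<open>On a complete measure space a.e. equality transfers measurability too. Thus the time
  integrand of the Fokker-Planck equation, with its inverse matrix, needs no separate measurability
  proof.\<close>

lemma has_bochner_integral_completion_cong_AE:
  assumes f: "has_bochner_integral (completion M) f x" and AE: "AE t in completion M. f t = g t"
  shows "has_bochner_integral (completion M) g x"
proof -
  have fm: "f \<in> borel_measurable (completion M)" using f by (rule borel_measurable_has_bochner_integral)
  have "g \<in> borel_measurable (completion M)"
  proof (rule measurableI)
    fix A :: "'b set" assume A: "A \<in> sets borel"
    show "g -` A \<inter> space (completion M) \<in> sets (completion M)"
    proof (rule completion.in_sets_AE)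
      show "AE t in completion M. t \<in> f -` A \<inter> space (completion M) \<longleftrightarrow> t \<in> g -` A \<inter> space (completion M)"
        using AE by eventually_elim auto
      show "f -` A \<inter> space (completion M) \<in> sets (completion M)"
        using fm A by (rule measurable_sets)
    qed auto
  qed simp
  with has_bochner_integral_cong_AE[OF fm _ AE] f show ?thesis by blast
qed

section \<open>Velocity and the Fokker--Planck equation\<close>

lemma second_moment_nth:
  assumes "\<mu> \<in> P2"
  shows "second_moment \<mu> $ i $ j = (\<integral>x. x $ i * x $ j \<partial>\<mu>)"
  unfolding second_moment_def by (rule outer_moments(2)[OF assms id_in_L2[OF assms] id_in_L2[OF assms]])

lemma second_moment_symmetric:
  assumes "\<mu> \<in> P2"
  shows "transpose (second_moment \<mu>) = second_moment \<mu>"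
  by (simp add: vec_eq_iff transpose_def second_moment_nth[OF assms] mult.commute)

lemma second_moment_quadratic:
  assumes "\<mu> \<in> P2"
  shows "integrable \<mu> (\<lambda>x. (x \<bullet> u)\<^sup>2)" "u \<bullet> (second_moment \<mu> *v u) = (\<integral>x. (x \<bullet> u)\<^sup>2 \<partial>\<mu>)"
proof -
  have eq: "(x \<bullet> u)\<^sup>2 = (\<Sum>i\<in>UNIV. \<Sum>j\<in>UNIV. u $ i * u $ j * (x $ i * x $ j))" for x
    by (simp add: inner_vec_def power2_eq_square sum_product ac_simps)
  have int: "integrable \<mu> (\<lambda>x. u $ i * u $ j * (x $ i * x $ j))" for i j
    by (intro integrable_mult_right outer_moments(1)[OF assms id_in_L2[OF assms] id_in_L2[OF assms]])
  show "integrable \<mu> (\<lambda>x. (x \<bullet> u)\<^sup>2)"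
    unfolding eq by (intro Bochner_Integration.integrable_sum int)
  have "(\<integral>x. (x \<bullet> u)\<^sup>2 \<partial>\<mu>) = (\<Sum>i\<in>UNIV. \<Sum>j\<in>UNIV. u $ i * u $ j * second_moment \<mu> $ i $ j)"
    unfolding eq second_moment_nth[OF assms]
    by (simp only: Bochner_Integration.integral_sum[OF Bochner_Integration.integrable_sum[OF int]]
        Bochner_Integration.integral_sum[OF int] integral_mult_right_zero)
  also have "\<dots> = u \<bullet> (second_moment \<mu> *v u)"
    by (simp add: inner_vec_def matrix_vector_mult_def sum_distrib_left ac_simps)
  finally show "u \<bullet> (second_moment \<mu> *v u) = (\<integral>x. (x \<bullet> u)\<^sup>2 \<partial>\<mu>)" ..
qed

text \<open>If \<open>x \<bullet> u = 0\<close> almost everywhere, testing \<open>\<xi>\<close> against \<open>(x \<bullet> u) u\<close> gives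
  \<open>0 = - u \<bullet> u\<close>.\<close>

lemma second_moment_positive_definite:
  assumes \<mu>: "\<mu> \<in> P2" and \<xi>: "\<xi> \<in> limiting_subdifferential gaussian_entropy \<mu>" and "u \<noteq> 0"
  shows "0 < u \<bullet> (second_moment \<mu> *v u)"
proof -
  have "(\<integral>x. (x \<bullet> u)\<^sup>2 \<partial>\<mu>) \<noteq> 0"
  proof
    assume "(\<integral>x. (x \<bullet> u)\<^sup>2 \<partial>\<mu>) = 0"
    then have "AE x in \<mu>. x \<bullet> u = 0"
      using integral_nonneg_eq_0_iff_AE[OF second_moment_quadratic(1)[OF \<mu>, of u]] by auto
    then have "AE x in \<mu>. (x \<bullet> u) * (u \<bullet> \<xi> x) = 0" "AE x in \<mu>. (x \<bullet> u) * (x \<bullet> u) = 0"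
      by (eventually_elim, simp)+
    then have "u \<bullet> u = 0"
      using limiting_subdifferential_moment[OF \<mu> \<xi>, of u u] by (simp add: integral_eq_zero_AE)
    then show False using \<open>u \<noteq> 0\<close> by simp
  qed
  moreover have "0 \<le> (\<integral>x. (x \<bullet> u)\<^sup>2 \<partial>\<mu>)" by simp
  ultimately show ?thesis unfolding second_moment_quadratic(2)[OF \<mu>] by linarith
qed

lemma positive_definite_invertible:
  fixes S :: "real^'n^'n"
  assumes "\<And>u. u \<noteq> 0 \<Longrightarrow> 0 < u \<bullet> (S *v u)"
  shows "invertible S"
proof -
  have "\<forall>x. S *v x = 0 \<longrightarrow> x = 0" using assms by fastforce
  then show ?thesis
    using matrix_left_invertible_ker[of S] invertible_left_inverse[of S] by blast
qed

text \<open>The moment of \<xi> against x is computed twice, from the definition of the mobility and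
  from the moment identity, which gives -2 (S B + B S) = S - I.\<close>

lemma velocity_moment_Lyapunov:
  fixes \<mu> :: "(real^'n) measure"
  assumes \<mu>: "\<mu> \<in> P2" and v: "v \<in> symmetric_fields \<mu>"
    and \<xi>: "(\<lambda>x. - mobility \<mu> v x) \<in> limiting_subdifferential gaussian_entropy \<mu>"
  defines "S \<equiv> second_moment \<mu>" and "B \<equiv> (\<integral>x. outer x (v x) \<partial>\<mu>)"
  shows "2 *\<^sub>R (S ** B + B ** S) = mat 1 - S"
proof -
  have vL: "v \<in> L2 \<mu>" and B: "transpose B = B"
    using v by (auto simp: symmetric_fields_def B_def)
  note id = id_in_L2[OF \<mu>]
  have Bsym: "B $ i $ j = B $ j $ i" for i j
    using arg_cong[OF B, of "\<lambda>M. M $ i $ j"] by (simp add: transpose_def)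
  \<comment> \<open>The indices are exchanged by the symmetry of \<open>B\<close>. Without it the
    product with S would contain the transpose of \<open>B\<close> and the equation would not be of
    Lyapunov form.\<close>
  have B_nth: "(\<integral>x. x $ j * v x $ k \<partial>\<mu>) = B $ k $ j" for j k
    using outer_moments(2)[OF \<mu> id vL, of j k] Bsym by (simp add: B_def)
  have "(2 *\<^sub>R (S ** B + B ** S)) $ i $ j = (mat 1 - S) $ i $ j" for i j
  proof -
    have \<xi>_nth: "x $ j * (- mobility \<mu> v x $ i) =
        (\<Sum>k\<in>UNIV. (-2 * S $ i $ k) * (x $ j * v x $ k) + (-2 * B $ i $ k) * (x $ k * x $ j))" for x
      by (simp add: mobility_def S_def B_def matrix_vector_mult_def sum_distrib_left sum.distrib
          sum_negf sum_subtractf algebra_simps)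
    have "(\<integral>x. x $ j * (- mobility \<mu> v x $ i) \<partial>\<mu>) = (\<Sum>k\<in>UNIV. -2 * S $ i $ k * B $ k $ j + -2 * B $ i $ k * S $ k $ j)"
      unfolding \<xi>_nth
      by (subst Bochner_Integration.integral_sum)
        (auto intro!: Bochner_Integration.integrable_add integrable_mult_right outer_moments(1)[OF \<mu>] id vL
          simp: outer_moments(1)[OF \<mu> id vL] outer_moments(1)[OF \<mu> id id] B_nth
            second_moment_nth[OF \<mu>, symmetric] S_def[symmetric])
    moreover have "(\<integral>x. x $ j * (- mobility \<mu> v x $ i) \<partial>\<mu>) = S $ i $ j - mat 1 $ i $ j"
    proof -
      have e: "axis i 1 \<bullet> (axis j 1 :: real^'n) = mat 1 $ i $ j"
        by (simp add: inner_axis_axis mat_def)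
      show ?thesis
        using limiting_subdifferential_moment[OF \<mu> \<xi>, of "axis j 1" "axis i 1"] unfolding e
        by (simp add: inner_axis inner_axis' S_def second_moment_nth[OF \<mu>])
    qed
    ultimately show ?thesis
      by (simp add: matrix_matrix_mult_def sum_distrib_left sum.distrib sum_negf sum_subtractf algebra_simps)
  qed
  then show ?thesis by (simp add: vec_eq_iff)
qed

text \<open>The candidate R - I satisfies the equation for 4 B, because S (R - I) + (R - I) S = 2 (I
  - S). Uniqueness is applied to the difference, which is symmetric since \<open>B\<close> is and R
  inverts a symmetric matrix.\<close>

lemma velocity_moment_eq:
  fixes \<mu> :: "(real^'n) measure"
  assumes \<mu>: "\<mu> \<in> P2" and v: "v \<in> symmetric_fields \<mu>"
    and \<xi>: "(\<lambda>x. - mobility \<mu> v x) \<in> limiting_subdifferential gaussian_entropy \<mu>"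
    and R: "R ** second_moment \<mu> = mat 1" "second_moment \<mu> ** R = mat 1"
  shows "transpose R = R" "4 *\<^sub>R (\<integral>x. outer x (v x) \<partial>\<mu>) = R - mat 1"
proof -
  define S where "S = second_moment \<mu>"
  define B where "B = (\<integral>x. outer x (v x) \<partial>\<mu>)"
  note R = R[folded S_def]
  have S: "transpose S = S" unfolding S_def by (rule second_moment_symmetric[OF \<mu>])
  have Rt1: "transpose R ** S = mat 1"
    using arg_cong[OF R(2), of transpose] by (simp add: matrix_transpose_mul S transpose_mat)
  have "transpose R = transpose R ** (S ** R)" by (simp add: R(2))
  also have "\<dots> = R" by (simp only: matrix_mul_assoc Rt1 matrix_mul_lid)
  finally show Rt: "transpose R = R" .
  have B: "transpose B = B" using v by (auto simp: symmetric_fields_def B_def)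
  have "4 *\<^sub>R B - (R - mat 1) = 0"
  proof (rule Lyapunov_unique)
    show "transpose (4 *\<^sub>R B - (R - mat 1)) = 4 *\<^sub>R B - (R - mat 1)"
      using B Rt by (simp add: transpose_def vec_eq_iff mat_def)
    show "0 < u \<bullet> (S *v u)" if "u \<noteq> 0" for u
      unfolding S_def by (rule second_moment_positive_definite[OF \<mu> \<xi> that])
    have "S ** (4 *\<^sub>R B - (R - mat 1)) + (4 *\<^sub>R B - (R - mat 1)) ** S =
        2 *\<^sub>R (2 *\<^sub>R (S ** B + B ** S)) - (S ** R + R ** S) + 2 *\<^sub>R S"
      by (simp add: matrix_mult_diff_distrib matrix_mult_scaleR scaleR_add_right scaleR_2)
    also have "\<dots> = 0"
      using velocity_moment_Lyapunov[OF \<mu> v \<xi>] R by (simp add: S_def B_def scaleR_2)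
    finally show "S ** (4 *\<^sub>R B - (R - mat 1)) + (4 *\<^sub>R B - (R - mat 1)) ** S = 0" .
  qed
  then show "4 *\<^sub>R (\<integral>x. outer x (v x) \<partial>\<mu>) = R - mat 1" by (simp add: B_def)
qed

section \<open>Testing the velocity against gradients\<close>

lemma gradient_nth: "gradient f x $ i = frechet_derivative f (at x) (axis i 1)"
  by (simp add: gradient_def)

lemma hessian_nth:
  "hessian f x $ i $ j = frechet_derivative (\<lambda>y. gradient f y $ i) (at x) (axis j 1)"
  by (simp add: hessian_def)

lemma test_functions_gradient_nth:
  "f \<in> test_functions UNIV \<Longrightarrow> (\<lambda>x. gradient f x $ i) \<in> test_functions UNIV"
  unfolding gradient_nth by (rule test_functions_frechet_derivative)

lemma integrable_test_function_mult_L2: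
  fixes g :: "real^'n \<Rightarrow> real"
  assumes "\<mu> \<in> P2" "w \<in> L2 \<mu>" "g \<in> test_functions UNIV"
  shows "integrable \<mu> (\<lambda>x. g x * w x $ i)"
proof -
  note \<mu> = P2D[OF assms(1)]
  note [measurable_cong] = \<mu>(2)
  interpret prob_space \<mu> by (rule \<mu>)
  have [measurable]: "(\<lambda>x. w x $ i) \<in> borel_measurable borel"
    using assms(2) by (auto simp: L2_def cart_eq_inner_axis intro!: borel_measurable_inner)
  note [measurable] = test_functions_continuous[OF assms(3), THEN borel_measurable_continuous_onI]
  obtain B where B: "\<And>x. \<bar>g x\<bar> \<le> B"
    using test_functions_bounded[OF assms(3)] by (auto simp: bounded_iff)
  show ?thesis
  proof (rule Bochner_Integration.integrable_bound)
    show "integrable \<mu> (\<lambda>x. B\<^sup>2 + (norm (w x))\<^sup>2)" using L2D(2)[OF assms(1,2)] by simp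
    have "\<bar>g x * w x $ i\<bar> \<le> B\<^sup>2 + (norm (w x))\<^sup>2" for x
    proof -
      have "0 \<le> B" using B[of 0] by linarith
      have "\<bar>g x * w x $ i\<bar> \<le> B * norm (w x)"
        unfolding abs_mult using B[of x] \<open>0 \<le> B\<close> by (intro mult_mono component_le_norm_cart) auto
      moreover have "0 \<le> B * norm (w x)" using \<open>0 \<le> B\<close> by simp
      ultimately show ?thesis using sum_squares_bound[of B "norm (w x)"] by linarith
    qed
    then show "AE x in \<mu>. norm (g x * w x $ i) \<le> norm (B\<^sup>2 + (norm (w x))\<^sup>2)" by simp
  qed measurable
qed

text \<open>Both integrands are expanded into double sums that differ only in replacing
  \<open>g i x * ?\<xi> x $ j\<close> by \<open>g i x * x $ j - hessian f x $ i $ j\<close>. These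
  have equal integrals by the first variation of the entropy. The separate integrability claims are
  needed to add the time derivative under the integral.\<close>

lemma integral_velocity_gradient:
  fixes \<mu> :: "(real^'n) measure" and f :: "real^'n \<Rightarrow> real"
  assumes \<mu>: "\<mu> \<in> P2" and v: "v \<in> symmetric_fields \<mu>"
    and \<xi>: "(\<lambda>x. - mobility \<mu> v x) \<in> limiting_subdifferential gaussian_entropy \<mu>"
    and R: "R ** second_moment \<mu> = mat 1" "second_moment \<mu> ** R = mat 1"
    and f: "f \<in> test_functions UNIV"
  shows "integrable \<mu> (\<lambda>x. v x \<bullet> gradient f x)"
    and "integrable \<mu> (\<lambda>x. 1/2 * trace (R ** hessian f x) - 1/4 * (((R + R ** R) *v x) \<bullet> gradient f x))"
    and "(\<integral>x. v x \<bullet> gradient f x \<partial>\<mu>) =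
      (\<integral>x. 1/2 * trace (R ** hessian f x) - 1/4 * (((R + R ** R) *v x) \<bullet> gradient f x) \<partial>\<mu>)"
proof -
  define S where "S = second_moment \<mu>"
  define B where "B = (\<integral>x. outer x (v x) \<partial>\<mu>)"
  let ?\<xi> = "\<lambda>x. - mobility \<mu> v x"
  have vL: "v \<in> L2 \<mu>" using v by (auto simp: symmetric_fields_def)
  have \<xi>L: "?\<xi> \<in> L2 \<mu>" using \<xi> by (auto simp: limiting_subdifferential_def)
  note Rt = velocity_moment_eq(1)[OF \<mu> v \<xi> R]
  have RR: "4 *\<^sub>R (R ** B) = R ** R - R"
    using arg_cong[OF velocity_moment_eq(2)[OF \<mu> v \<xi> R], of "\<lambda>M. R ** M"]
    by (simp add: B_def matrix_mult_diff_distrib matrix_mult_scaleR)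
  have Rsym: "R $ i $ j = R $ j $ i" for i j
    using arg_cong[OF Rt, of "\<lambda>M. M $ i $ j"] by (simp add: transpose_def)
  define g where "g i x = gradient f x $ i" for i x
  have g: "g i \<in> test_functions UNIV" for i
    unfolding g_def by (rule test_functions_gradient_nth[OF f])
  have h: "(\<lambda>x. hessian f x $ i $ j) \<in> test_functions UNIV" for i j
    unfolding hessian_nth by (intro test_functions_frechet_derivative test_functions_gradient_nth f)
  note intg = integrable_test_function_mult_L2[OF \<mu> _ g]
  have intxg: "integrable \<mu> (\<lambda>x. g i x * x $ j)" for i j by (rule intg[OF id_in_L2[OF \<mu>]])
  have inth: "integrable \<mu> (\<lambda>x. hessian f x $ i $ j)" for i j
    by (rule integrable_test_function[OF P2D(1,2)[OF \<mu>] h])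
  \<comment> \<open>R is applied to the definition of the mobility; the nonlocal term becomes
    \<open>(R ** B) *v x\<close>, which \<open>RR\<close> makes explicit.\<close>
  have v_eq: "v x = - (1/2) *\<^sub>R (R *v ?\<xi> x) - (1/4) *\<^sub>R ((R ** R - R) *v x)" for x
  proof -
    have "R *v ?\<xi> x = - 2 *\<^sub>R ((R ** S) *v v x) - 2 *\<^sub>R ((R ** B) *v x)"
      by (simp add: mobility_def S_def B_def matrix_vector_mul_assoc[symmetric]
          matrix_vector_mult_diff_distrib matrix_vector_mult_scaleR matrix_vector_right_distrib
          linear_neg[OF matrix_vector_mul_linear])
    also have "R ** S = mat 1" using R(1) by (simp add: S_def)
    finally have "R *v ?\<xi> x = - 2 *\<^sub>R v x - 2 *\<^sub>R ((R ** B) *v x)" by simp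
    then have "(1/2) *\<^sub>R (R *v ?\<xi> x) = - v x - (R ** B) *v x" by (simp add: scaleR_diff_right)
    moreover have "(R ** R - R) *v x = 4 *\<^sub>R ((R ** B) *v x)"
      unfolding RR[symmetric] by (simp add: scaleR_matrix_vector_assoc)
    then have "(1/4) *\<^sub>R ((R ** R - R) *v x) = (R ** B) *v x" by simp
    ultimately show ?thesis by simp
  qed
  have lhs: "v x \<bullet> gradient f x = (\<Sum>i\<in>UNIV. \<Sum>j\<in>UNIV.
      R $ i $ j * (- (1/2) * (g i x * ?\<xi> x $ j)) - (R ** R - R) $ i $ j * (1/4 * (g i x * x $ j)))" for x
    unfolding v_eq[of x]
    by (simp add: inner_vec_def g_def matrix_vector_mult_def sum_distrib_left sum_distrib_right
        sum_subtractf sum_negf left_diff_distrib right_diff_distrib diff_divide_distrib ac_simps)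
  have rhs: "1/2 * trace (R ** hessian f x) - 1/4 * (((R + R ** R) *v x) \<bullet> gradient f x) =
    (\<Sum>i\<in>UNIV. \<Sum>j\<in>UNIV. R $ i $ j * (- (1/2) * (g i x * x $ j - hessian f x $ i $ j))
      - (R ** R - R) $ i $ j * (1/4 * (g i x * x $ j)))" for x
  proof -
    \<comment> \<open>The trace pairs the Hessian with the transposed entries of R, so the symmetry
      of R is used when this is matched with the other sum.\<close>
    have "trace (R ** hessian f x) = (\<Sum>i\<in>UNIV. \<Sum>j\<in>UNIV. R $ j $ i * hessian f x $ i $ j)"
      unfolding trace_def matrix_matrix_mult_def by (simp, subst sum.swap, simp)
    moreover have "((R + R ** R) *v x) \<bullet> gradient f x = (\<Sum>i\<in>UNIV. \<Sum>j\<in>UNIV. (R $ i $ j + (R ** R) $ i $ j) * (g i x * x $ j))"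
      by (simp add: inner_vec_def g_def matrix_vector_mult_def sum_distrib_left sum_distrib_right ac_simps)
    ultimately show ?thesis
      by (simp add: Rsym sum_distrib_left sum_subtractf[symmetric])
        (intro sum.cong refl, simp add: field_simps)
  qed
  have int_l: "integrable \<mu> (\<lambda>x. R $ i $ j * (- (1/2) * (g i x * ?\<xi> x $ j)) - (R ** R - R) $ i $ j * (1/4 * (g i x * x $ j)))"
    for i j
    by (intro Bochner_Integration.integrable_diff integrable_mult_right intg \<xi>L intxg)
  have int_r: "integrable \<mu> (\<lambda>x. R $ i $ j * (- (1/2) * (g i x * x $ j - hessian f x $ i $ j))
      - (R ** R - R) $ i $ j * (1/4 * (g i x * x $ j)))" for i j
    by (intro Bochner_Integration.integrable_diff integrable_mult_right intxg inth)
  show "integrable \<mu> (\<lambda>x. v x \<bullet> gradient f x)"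
    unfolding lhs by (intro Bochner_Integration.integrable_sum int_l)
  show "integrable \<mu> (\<lambda>x. 1/2 * trace (R ** hessian f x) - 1/4 * (((R + R ** R) *v x) \<bullet> gradient f x))"
    unfolding rhs by (intro Bochner_Integration.integrable_sum int_r)
  \<comment> \<open>The first variation with the i-th partial derivative of \<open>f\<close> as test
    function and the j-th axis as direction; its directional derivative is the Hessian
    entry.\<close>
  have ibp: "(\<integral>x. g i x * ?\<xi> x $ j \<partial>\<mu>) = (\<integral>x. g i x * x $ j - hessian f x $ i $ j \<partial>\<mu>)" for i j
    using limiting_subdifferential_first_variation[OF \<xi> g, of i "axis j 1"]
    by (simp add: inner_axis inner_axis' hessian_nth g_def[abs_def] mult.commute)
  have "(\<integral>x. R $ i $ j * (- (1/2) * (g i x * ?\<xi> x $ j)) - (R ** R - R) $ i $ j * (1/4 * (g i x * x $ j)) \<partial>\<mu>) =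
    (\<integral>x. R $ i $ j * (- (1/2) * (g i x * x $ j - hessian f x $ i $ j)) - (R ** R - R) $ i $ j * (1/4 * (g i x * x $ j)) \<partial>\<mu>)"
    for i j
  proof -
    have "(\<integral>x. R $ i $ j * (- (1/2) * (g i x * ?\<xi> x $ j)) - (R ** R - R) $ i $ j * (1/4 * (g i x * x $ j)) \<partial>\<mu>) =
      R $ i $ j * (- (1/2) * (\<integral>x. g i x * ?\<xi> x $ j \<partial>\<mu>)) - (R ** R - R) $ i $ j * (1/4 * (\<integral>x. g i x * x $ j \<partial>\<mu>))"
      by (simp only: integral_mult_right_zero Bochner_Integration.integral_diff[OF
            integrable_mult_right[OF integrable_mult_right[OF intg[OF \<xi>L]]]
            integrable_mult_right[OF integrable_mult_right[OF intxg]]])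
    also have "\<dots> = (\<integral>x. R $ i $ j * (- (1/2) * (g i x * x $ j - hessian f x $ i $ j)) - (R ** R - R) $ i $ j * (1/4 * (g i x * x $ j)) \<partial>\<mu>)"
      unfolding ibp
      by (simp only: integral_mult_right_zero Bochner_Integration.integral_diff[OF
            integrable_mult_right[OF integrable_mult_right[OF Bochner_Integration.integrable_diff[OF intxg inth]]]
            integrable_mult_right[OF integrable_mult_right[OF intxg]]])
    finally show ?thesis .
  qed
  then show "(\<integral>x. v x \<bullet> gradient f x \<partial>\<mu>) =
      (\<integral>x. 1/2 * trace (R ** hessian f x) - 1/4 * (((R + R ** R) *v x) \<bullet> gradient f x) \<partial>\<mu>)"
    unfolding lhs rhs
    by (simp only: Bochner_Integration.integral_sum[OF Bochner_Integration.integrable_sum[OF int_l]]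
        Bochner_Integration.integral_sum[OF Bochner_Integration.integrable_sum[OF int_r]]
        Bochner_Integration.integral_sum[OF int_l] Bochner_Integration.integral_sum[OF int_r])
qed

theorem theorem4p1:
  fixes \<rho>0 :: "(real^'n) measure" and \<rho> :: "real \<Rightarrow> (real^'n) measure"
  assumes "\<rho>0 \<in> P2"
    and "invertible (second_moment \<rho>0)"
    and "relative_entropy \<rho>0 std_gaussian < \<infinity>"
    and "IGW_gradient_flow \<rho>0 \<rho>"
  shows "solves_IGW_Fokker_Planck \<rho>"
proof -
  obtain v where P2: "\<And>t. 0 \<le> t \<Longrightarrow> \<rho> t \<in> P2" and ce: "continuity_equation \<rho> v"
    and AE: "AE t in lebesgue. 0 < t \<longrightarrow> v t \<in> symmetric_fields (\<rho> t) \<and>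
        (\<lambda>x. - mobility (\<rho> t) (v t) x) \<in> limiting_subdifferential gaussian_entropy (\<rho> t)"
    using assms(4) by (auto simp: IGW_gradient_flow_def W2_continuous_on_def IGW_velocity_field_def)
  have inv: "invertible (second_moment (\<rho> t))"
    if "0 < t" "(\<lambda>x. - mobility (\<rho> t) (v t) x) \<in> limiting_subdifferential gaussian_entropy (\<rho> t)" for t
    using second_moment_positive_definite[OF P2 that(2)] that(1)
    by (intro positive_definite_invertible) auto
  show ?thesis
    unfolding solves_IGW_Fokker_Planck_def
  proof (intro conjI ballI)
    show "AE t in lebesgue. 0 < t \<longrightarrow> invertible (second_moment (\<rho> t))"
      using AE by eventually_elim (use inv in auto)
    fix \<phi> :: "real \<times> (real^'n) \<Rightarrow> real" assume \<phi>: "\<phi> \<in> test_functions ({0<..} \<times> UNIV)"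
    let ?F = "\<lambda>t. indicator {0<..} t *\<^sub>R
       (\<integral>x. deriv (\<lambda>s. \<phi> (s, x)) t + v t x \<bullet> gradient (\<lambda>y. \<phi> (t, y)) x \<partial>\<rho> t)"
    let ?G = "\<lambda>t. indicator {0<..} t *\<^sub>R
       (let R = matrix_inv (second_moment (\<rho> t)) in
        \<integral>x. deriv (\<lambda>s. \<phi> (s, x)) t
          + 1/2 * trace (R ** hessian (\<lambda>y. \<phi> (t, y)) x)
          - 1/4 * (((R + R ** R) *v x) \<bullet> gradient (\<lambda>y. \<phi> (t, y)) x) \<partial>\<rho> t)"
    show "has_bochner_integral lebesgue ?G 0"
    proof (rule has_bochner_integral_completion_cong_AE)
      show "has_bochner_integral lebesgue ?F 0"
        using ce \<phi> by (auto simp: continuity_equation_def)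
      \<comment> \<open>It suffices to compare spatial integrals at almost every fixed time. For t
        \<le> 0 the indicator makes both sides 0.\<close>
      show "AE t in lebesgue. ?F t = ?G t"
        using AE
      proof eventually_elim
        case (elim t)
        show ?case
        proof (cases "0 < t")
          case True
          let ?R = "matrix_inv (second_moment (\<rho> t))" and ?f = "\<lambda>y. \<phi> (t, y)"
          note \<mu> = P2[OF less_imp_le[OF True]]
          have v: "v t \<in> symmetric_fields (\<rho> t)"
            and \<xi>: "(\<lambda>x. - mobility (\<rho> t) (v t) x) \<in> limiting_subdifferential gaussian_entropy (\<rho> t)"
            using elim True by auto
          \<comment> \<open>\<open>matrix_inv\<close> is a choice of two-sided inverse, so both laws
            rest on the invertibility at time t.\<close>
          have R: "?R ** second_moment (\<rho> t) = mat 1" "second_moment (\<rho> t) ** ?R = mat 1"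
            using someI_ex[OF inv[OF True \<xi>, unfolded invertible_def]] by (auto simp: matrix_inv_def)
          have f: "?f \<in> test_functions UNIV" by (rule test_functions_slice[OF \<phi>])
          have "(\<lambda>x. deriv (\<lambda>s. \<phi> (s, x)) t) \<in> test_functions UNIV"
            unfolding deriv_time_slice[OF \<phi>]
            by (rule test_functions_slice[OF test_functions_frechet_derivative[OF test_functions_UNIV[OF \<phi>]]])
          then have int: "integrable (\<rho> t) (\<lambda>x. deriv (\<lambda>s. \<phi> (s, x)) t)"
            by (rule integrable_test_function[OF P2D(1,2)[OF \<mu>]])
          note I = integral_velocity_gradient[OF \<mu> v \<xi> R f]
          show ?thesis
            unfolding Let_def add_diff_eq[symmetric]
            using I(3) by (simp only: Bochner_Integration.integral_add[OF int I(1)]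
                Bochner_Integration.integral_add[OF int I(2)])
        qed simp
      qed
    qed
  qed
qed

end
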